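(* Fix $S_B\in(0,S_o)$ and let $(S_T,\tau)\in\mathcal B=\{(S_T,\tau):\tau>\bar\tau,\ \check S_B(\tau)<S_T<\hat S_B(\tau)\}$. Consider the system $$S'=\frac1{c_d\tau}\mathcal F(S,p),\qquad p'=\mathcal G(S;\hat S_B(\tau),S_T),\qquad c_d=\frac{F(\hat S_B(\tau))-F(S_T)}{\hat S_B(\tau)-S_T}.$$ For this system there exists an orbit $(S_d,p_d)$ that connects $E^d_{\hat S_B(\tau)}$ (for $\xi\to-\infty$) to the segment $\overline{E^i_{S_T}E^d_{S_T}}$ (for $\xi\to\infty$).
   Context: Capillary pressures. $p_c^{(i)},p_c^{(d)}:(0,1]\to[0,\infty)$ are $C^1$ on $(0,1]$, vanish at $S=1$, have strictly negative derivative on $(0,1)$, and $p_c^{(i)}(S)<p_c^{(d)}(S)$ for $0<S<1$. Define $\mathcal H^{(i)}=\{(S,p):0<S\le1,\ p<p_c^{(i)}(S)\}$, $\mathcal H^{(d)}=\{(S,p):0<S\le1,\ p>p_c^{(d)}(S)\}$, $\mathcal H=\{(S,p):0<S\le1,\ p_c^{(i)}(S)\le p\le p_c^{(d)}(S)\}$, and $\mathcal F(S,p)=p_c^{(d)}(S)-p$ on $\mathcal H^{(d)}$, $\mathcal F=0$ on $\mathcal H$, $\mathcal F(S,p)=p_c^{(i)}(S)-p$ on $\mathcal H^{(i)}$. Notation: $E^j_K=(K,p_c^{(j)}(K))$, $j\in\{i,d\}$. Connecting to a segment for $\xi\to\infty$ means that the distance to the (equilibrium) segment tends to $0$ as $\xi\to\infty$.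 Flux functions (no relative-permeability hysteresis). $k_{rw},k_{rn}\in C^2([0,1])$ are strictly convex, $k_{rw}(0)=0$, $k_{rw}'>0$ on $(0,1]$, $k_{rn}(1)=0$, $k_{rn}'<0$ on $[0,1)$. With constants $M>0$ and $N_g$: $f=k_{rw}/(k_{rw}+Mk_{rn})$, $h=k_{rn}f$, $F=f+N_gh$. $N_g$ is small enough that $F\in C^2([0,1])$, $F'>0$ on $(0,1)$, $F(0)=0$, $F(1)=1$ and there is a unique $S_o\in(0,1)$ with $F''(S_o)=0$, $F''>0$ on $(0,S_o)$, $F''<0$ on $(S_o,1)$. For $A\ne\alpha$, $\mathcal G(S;A,\alpha)=\dfrac{F(S)-F(A)-\frac{F(\alpha)-F(A)}{\alpha-A}(S-A)}{h(S)}$ (slope $F'(A)$ in place of the difference quotient if $\alpha=A$). Saturations. $\underline S\in(0,S_o)$ is the saturation with $F'(\underline S)=\frac{1-F(\underline S)}{1-\underline S}$. For $0<S_B<S_o$, $\bar S\in(S_B,1)$ is the saturation with $F'(\bar S)=\frac{F(\bar S)-F(S_B)}{\bar S-S_B}$. If $S_B<\underline S$, $\tilde S\in(S_B,\bar S)$ is the saturation where the graph of $F$ meets the line through $(S_B,F(S_B))$ and $(1,1)$; if $S_B\ge\underline S$, set $\tilde S:=S_B$. For $\alpha\in[\tilde S,\bar S]$, $\beta(\alpha)\in[\bar S,1]$ is such that $(\beta(\alpha),F(\beta(\alpha)))$ is the third intersection point of the graph of $F$ with the chord through $(S_B,F(S_B))$ and $(\alpha,F(\alpha))$ (the tangent line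 at $S_B$ if $\alpha=S_B$), with $\beta(\bar S)=\bar S$; $\beta$ is strictly decreasing. Standing assumption: $\mathcal G(\cdot;S_B,\alpha)$ is non-integrable near $S=1$ for each $S_B\le\alpha\le\bar S$. $\gamma$ is the increasing non-trivial root of $\int_{S_B}^{\gamma(\alpha)}\mathcal G(S;S_B,\alpha)\,dS=0$, with $\gamma(S_B)=S_B$, $\gamma(\alpha)>\alpha$ for $\alpha>S_B$, defined on $[S_B,S_*]$, where $S_*\in(\tilde S,\bar S)$ is the point at which $\gamma(S_* )=\beta(S_* )$. For $\tau>0$ and $S_B<S_T\le\bar S$, with $c=\frac{F(S_T)-F(S_B)}{S_T-S_B}$, let $w(\cdot;\tau,S_T)$ be the (unique) solution of $w'(S)=\frac{c\tau\,\mathcal G(S;S_B,S_T)}{p_c^{(i)}(S)-w(S)}$ for $S>S_B$, with $w(S_B)=p_c^{(i)}(S_B)$ and $w<p_c^{(i)}$ in a right neighbourhood of $S_B$. Let $S_m(\tau,S_T)=\sup\{S\in(S_B,1):w(\varrho;\tau,S_T)<p_c^{(i)}(\varrho)\text{ for all }S_B<\varrho<S\}$ and $\tau_m(S_T)=\sup\{\tau>0:S_m(\tau,S_T)=S_T\}$. For $S_T\in(S_*,\bar S)$, $\tau_c(S_T)$ is the unique $\tau>0$ with $S_m(\tau,S_T)=\beta(S_T)$. The function $\tau_c$ is strictly decreasing and continuous, $\tau_c(S_T)\to\infty$ as $S_T\searrow S_*$, and it is extended continuously to $\bar S$ by $\tau_c(\bar S)=\bar\tau:=\tau_m(\bar S)>0$.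 Finally $\check S_B(\tau)=\tau_c^{-1}(\tau)$ for $\tau>\bar\tau$, $\check S_B(\tau)=\bar S$ for $0\le\tau\le\bar\tau$, and $\hat S_B(\tau)=\beta(\check S_B(\tau))$. *)

theory Defs
  imports "HOL-Analysis.Analysis"
begin

section \<open>Smoothness and convexity\<close>

text \<open>Derivatives are taken within \<^term>\<open>X\<close>, i.e. one-sided at the end points of an interval.\<close>

primrec C_k_on :: "nat \<Rightarrow> (real \<Rightarrow> real) \<Rightarrow> real set \<Rightarrow> bool" where
  "C_k_on 0 f X \<longleftrightarrow> continuous_on X f"
| "C_k_on (Suc k) f X \<longleftrightarrow>
     (\<exists>f'. (\<forall>x\<in>X. (f has_real_derivative f' x) (at x within X)) \<and> C_k_on k f' X)"

definition strictly_convex_on :: "real set \<Rightarrow> (real \<Rightarrow> real) \<Rightarrow> bool" where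
  "strictly_convex_on X f \<longleftrightarrow> convex X \<and>
     (\<forall>x\<in>X. \<forall>y\<in>X. \<forall>t\<in>{0<..<1}. x \<noteq> y \<longrightarrow>
        f ((1 - t) * x + t * y) < (1 - t) * f x + t * f y)"

section \<open>Capillary pressures\<close>

definition capillary_pressure :: "(real \<Rightarrow> real) \<Rightarrow> bool" where
  "capillary_pressure pc \<longleftrightarrow>
     C_k_on 1 pc {0<..1} \<and> (\<forall>S\<in>{0<..1}. 0 \<le> pc S) \<and> pc 1 = 0 \<and>
     (\<forall>S\<in>{0<..<1}. deriv pc S < 0)"

definition H_imb :: "(real \<Rightarrow> real) \<Rightarrow> (real \<times> real) set" where
  "H_imb pci = {(S, p). 0 < S \<and> S \<le> 1 \<and> p < pci S}"

definition H_dra :: "(real \<Rightarrow> real) \<Rightarrow> (real \<times> real) set" where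
  "H_dra pcd = {(S, p). 0 < S \<and> S \<le> 1 \<and> pcd S < p}"

text \<open>On the strip \<open>0 < S \<le> 1\<close> the last branch is the set \<open>pci S \<le> p \<le> pcd S\<close>; outside the strip
  the value \<open>0\<close> is a dummy.\<close>

definition calF :: "(real \<Rightarrow> real) \<Rightarrow> (real \<Rightarrow> real) \<Rightarrow> real \<Rightarrow> real \<Rightarrow> real" where
  "calF pci pcd S p =
     (if (S, p) \<in> H_dra pcd then pcd S - p
      else if (S, p) \<in> H_imb pci then pci S - p
      else 0)"

definition E_point :: "(real \<Rightarrow> real) \<Rightarrow> real \<Rightarrow> real \<times> real" where
  "E_point pc K = (K, pc K)"

section \<open>Flux functions\<close>

definition rel_perm_wetting :: "(real \<Rightarrow> real) \<Rightarrow> bool" where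
  "rel_perm_wetting krw \<longleftrightarrow>
     C_k_on 2 krw {0..1} \<and> strictly_convex_on {0..1} krw \<and> krw 0 = 0 \<and>
     (\<forall>S\<in>{0<..1}. \<exists>d>0. (krw has_real_derivative d) (at S within {0..1}))"

definition rel_perm_nonwetting :: "(real \<Rightarrow> real) \<Rightarrow> bool" where
  "rel_perm_nonwetting krn \<longleftrightarrow>
     C_k_on 2 krn {0..1} \<and> strictly_convex_on {0..1} krn \<and> krn 1 = 0 \<and>
     (\<forall>S\<in>{0..<1}. \<exists>d<0. (krn has_real_derivative d) (at S within {0..1}))"

definition flux_f :: "(real \<Rightarrow> real) \<Rightarrow> (real \<Rightarrow> real) \<Rightarrow> real \<Rightarrow> real \<Rightarrow> real" where
  "flux_f krw krn M S = krw S / (krw S + M * krn S)"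

definition flux_h :: "(real \<Rightarrow> real) \<Rightarrow> (real \<Rightarrow> real) \<Rightarrow> real \<Rightarrow> real \<Rightarrow> real" where
  "flux_h krw krn M S = krn S * flux_f krw krn M S"

definition flux_F :: "(real \<Rightarrow> real) \<Rightarrow> (real \<Rightarrow> real) \<Rightarrow> real \<Rightarrow> real \<Rightarrow> real \<Rightarrow> real" where
  "flux_F krw krn M Ng S = flux_f krw krn M S + Ng * flux_h krw krn M S"

definition convex_concave_flux :: "(real \<Rightarrow> real) \<Rightarrow> real \<Rightarrow> bool" where
  "convex_concave_flux F So \<longleftrightarrow>
     C_k_on 2 F {0..1} \<and> (\<forall>S\<in>{0<..<1}. deriv F S > 0) \<and> F 0 = 0 \<and> F 1 = 1 \<and>
     So \<in> {0<..<1} \<and> deriv (deriv F) So = 0 \<and>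
     (\<forall>S\<in>{0<..<So}. deriv (deriv F) S > 0) \<and>
     (\<forall>S\<in>{So<..<1}. deriv (deriv F) S < 0)"

text \<open>Slope of the chord of the graph of \<open>F\<close> through \<open>A\<close> and \<open>\<alpha>\<close>, of the tangent if
  \<open>\<alpha> = A\<close>.\<close>

definition chord_slope :: "(real \<Rightarrow> real) \<Rightarrow> real \<Rightarrow> real \<Rightarrow> real" where
  "chord_slope F A \<alpha> = (if \<alpha> = A then deriv F A else (F \<alpha> - F A) / (\<alpha> - A))"

definition calG :: "(real \<Rightarrow> real) \<Rightarrow> (real \<Rightarrow> real) \<Rightarrow> real \<Rightarrow> real \<Rightarrow> real \<Rightarrow> real" where
  "calG F h S A \<alpha> = (F S - F A - chord_slope F A \<alpha> * (S - A)) / h S"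

section \<open>Distinguished saturations\<close>

definition is_S_lower :: "(real \<Rightarrow> real) \<Rightarrow> real \<Rightarrow> real \<Rightarrow> bool" where
  "is_S_lower F So S_lower \<longleftrightarrow>
     S_lower \<in> {0<..<So} \<and> deriv F S_lower = (1 - F S_lower) / (1 - S_lower)"

definition is_S_bar :: "(real \<Rightarrow> real) \<Rightarrow> real \<Rightarrow> real \<Rightarrow> bool" where
  "is_S_bar F SB S_bar \<longleftrightarrow>
     S_bar \<in> {SB<..<1} \<and> deriv F S_bar = (F S_bar - F SB) / (S_bar - SB)"

definition is_S_tilde :: "(real \<Rightarrow> real) \<Rightarrow> real \<Rightarrow> real \<Rightarrow> real \<Rightarrow> real \<Rightarrow> bool" where
  "is_S_tilde F SB S_lower S_bar S_tilde \<longleftrightarrow>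
     (if SB < S_lower
      then S_tilde \<in> {SB<..<S_bar} \<and>
           F S_tilde = F SB + (1 - F SB) / (1 - SB) * (S_tilde - SB)
      else S_tilde = SB)"

text \<open>For \<open>\<alpha> < S_bar\<close> the intersection point found in \<open>[S_bar, 1]\<close> is automatically different from
  those at \<open>SB\<close> and \<open>\<alpha>\<close>.\<close>

definition is_beta ::
  "(real \<Rightarrow> real) \<Rightarrow> real \<Rightarrow> real \<Rightarrow> real \<Rightarrow> (real \<Rightarrow> real) \<Rightarrow> bool" where
  "is_beta F SB S_tilde S_bar \<beta> \<longleftrightarrow>
     (\<forall>\<alpha>\<in>{S_tilde..S_bar}.
        \<beta> \<alpha> \<in> {S_bar..1} \<and> F (\<beta> \<alpha>) = F SB + chord_slope F SB \<alpha> * (\<beta> \<alpha> - SB)) \<and>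
     \<beta> S_bar = S_bar \<and> strict_antimono_on {S_tilde..S_bar} \<beta>"

definition nonintegrable_near_1 :: "(real \<Rightarrow> real) \<Rightarrow> bool" where
  "nonintegrable_near_1 g \<longleftrightarrow> (\<forall>a\<in>{0<..<1}. \<not> g absolutely_integrable_on {a<..<1})"

definition is_gamma ::
  "(real \<Rightarrow> real) \<Rightarrow> (real \<Rightarrow> real) \<Rightarrow> real \<Rightarrow> real \<Rightarrow> (real \<Rightarrow> real) \<Rightarrow> bool" where
  "is_gamma F h SB S_star \<gamma> \<longleftrightarrow>
     (\<forall>\<alpha>\<in>{SB..S_star}. ((\<lambda>S. calG F h S SB \<alpha>) has_integral 0) {SB..\<gamma> \<alpha>}) \<and>
     \<gamma> SB = SB \<and> (\<forall>\<alpha>\<in>{SB<..S_star}. \<alpha> < \<gamma> \<alpha>) \<and> strict_mono_on {SB..S_star} \<gamma>"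

section \<open>The imbibition orbits and the critical values of \<open>\<tau>\<close>\<close>

definition S_m :: "(real \<Rightarrow> real) \<Rightarrow> real \<Rightarrow> (real \<Rightarrow> real) \<Rightarrow> real" where
  "S_m pci SB u = Sup {S \<in> {SB<..<1}. \<forall>\<rho>\<in>{SB<..<S}. u \<rho> < pci \<rho>}"

text \<open>The differential equation is singular where \<open>u = pci\<close>, so it is only imposed up to the
  first contact point \<open>S_m\<close>. Continuity up to and including \<open>S_m\<close> (if \<open>S_m < 1\<close>) makes
  \<open>S_m\<close> a genuine contact point: \<open>u\<close> is a maximal solution below \<open>pci\<close>. Beyond \<open>S_m\<close> the
  values of \<open>u\<close> are irrelevant.\<close>

definition imbibition_solution ::
  "(real \<Rightarrow> real) \<Rightarrow> (real \<Rightarrow> real) \<Rightarrow> (real \<Rightarrow> real) \<Rightarrow> real \<Rightarrow> real \<Rightarrow> real \<Rightarrow> (real \<Rightarrow> real) \<Rightarrow> bool"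
where
  "imbibition_solution F h pci SB \<tau> ST u \<longleftrightarrow>
     u SB = pci SB \<and>
     (\<forall>\<^sub>F S in at_right SB. u S < pci S) \<and>
     continuous_on ({SB..S_m pci SB u} \<inter> {..<1}) u \<and>
     (\<forall>S\<in>{SB<..<S_m pci SB u}.
        (u has_real_derivative
           (F ST - F SB) / (ST - SB) * \<tau> * calG F h S SB ST / (pci S - u S)) (at S))"

text \<open>Here \<open>w \<tau> ST\<close> is the imbibition solution with parameters \<open>\<tau>\<close> and \<open>ST\<close>.\<close>

definition tau_m ::
  "(real \<Rightarrow> real) \<Rightarrow> real \<Rightarrow> (real \<Rightarrow> real \<Rightarrow> real \<Rightarrow> real) \<Rightarrow> real \<Rightarrow> real" where
  "tau_m pci SB w ST = Sup {\<tau>. \<tau> > 0 \<and> S_m pci SB (w \<tau> ST) = ST}"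

definition is_tau_c ::
  "(real \<Rightarrow> real) \<Rightarrow> real \<Rightarrow> (real \<Rightarrow> real \<Rightarrow> real \<Rightarrow> real) \<Rightarrow> (real \<Rightarrow> real) \<Rightarrow> real \<Rightarrow> real
     \<Rightarrow> (real \<Rightarrow> real) \<Rightarrow> bool" where
  "is_tau_c pci SB w \<beta> S_star S_bar \<tau>c \<longleftrightarrow>
     (\<forall>ST\<in>{S_star<..<S_bar}. \<forall>\<tau>>0. S_m pci SB (w \<tau> ST) = \<beta> ST \<longleftrightarrow> \<tau> = \<tau>c ST) \<and>
     (\<forall>ST\<in>{S_star<..<S_bar}. \<tau>c ST > 0) \<and>
     \<tau>c S_bar = tau_m pci SB w S_bar \<and>
     strict_antimono_on {S_star<..S_bar} \<tau>c \<and>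
     continuous_on {S_star<..S_bar} \<tau>c \<and>
     filterlim \<tau>c at_top (at_right S_star)"

definition S_check :: "(real \<Rightarrow> real) \<Rightarrow> real \<Rightarrow> real \<Rightarrow> real \<Rightarrow> real \<Rightarrow> real" where
  "S_check \<tau>c S_star S_bar \<tau>_bar \<tau> =
     (if \<tau> > \<tau>_bar then inv_into {S_star<..S_bar} \<tau>c \<tau> else S_bar)"

definition S_hat ::
  "(real \<Rightarrow> real) \<Rightarrow> (real \<Rightarrow> real) \<Rightarrow> real \<Rightarrow> real \<Rightarrow> real \<Rightarrow> real \<Rightarrow> real" where
  "S_hat \<beta> \<tau>c S_star S_bar \<tau>_bar \<tau> = \<beta> (S_check \<tau>c S_star S_bar \<tau>_bar \<tau>)"

definition region_B ::
  "(real \<Rightarrow> real) \<Rightarrow> (real \<Rightarrow> real) \<Rightarrow> real \<Rightarrow> real \<Rightarrow> real \<Rightarrow> (real \<times> real) set" where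
  "region_B \<beta> \<tau>c S_star S_bar \<tau>_bar =
     {(ST, \<tau>). \<tau> > \<tau>_bar \<and> S_check \<tau>c S_star S_bar \<tau>_bar \<tau> < ST \<and>
                ST < S_hat \<beta> \<tau>c S_star S_bar \<tau>_bar \<tau>}"

section \<open>Orbits\<close>

text \<open>Global classical solutions of \<open>S' = \<F>(S, p) / (c \<tau>)\<close>, \<open>p' = \<G>(S; A, \<alpha>)\<close>. The orbit must stay
  in \<open>0 < S < 1\<close>, where the right-hand sides are defined (\<open>h\<close> vanishes at \<open>0\<close> and \<open>1\<close>).\<close>

definition tw_orbit ::
  "(real \<Rightarrow> real) \<Rightarrow> (real \<Rightarrow> real) \<Rightarrow> (real \<Rightarrow> real) \<Rightarrow> (real \<Rightarrow> real) \<Rightarrow> real \<Rightarrow> real \<Rightarrow> real \<Rightarrow> real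
     \<Rightarrow> (real \<Rightarrow> real) \<Rightarrow> (real \<Rightarrow> real) \<Rightarrow> bool" where
  "tw_orbit F h pci pcd c \<tau> A \<alpha> S p \<longleftrightarrow>
     (\<forall>\<xi>. S \<xi> \<in> {0<..<1} \<and>
          (S has_real_derivative 1 / (c * \<tau>) * calF pci pcd (S \<xi>) (p \<xi>)) (at \<xi>) \<and>
          (p has_real_derivative calG F h (S \<xi>) A \<alpha>) (at \<xi>))"

definition connects_point_to_segment ::
  "(real \<Rightarrow> real) \<Rightarrow> (real \<Rightarrow> real) \<Rightarrow> real \<times> real \<Rightarrow> (real \<times> real) set \<Rightarrow> bool" where
  "connects_point_to_segment S p E L \<longleftrightarrow>
     ((\<lambda>\<xi>. (S \<xi>, p \<xi>)) \<longlongrightarrow> E) at_bot \<and>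
     ((\<lambda>\<xi>. infdist (S \<xi>, p \<xi>) L) \<longlongrightarrow> 0) at_top"

end

theory Submission
  imports Defs
begin

text \<open>
  The system is a damped oscillator. With \<open>\<kappa> = c_d * \<tau>\<close> and a primitive \<open>\<Phi>\<close> of
  \<open>S \<mapsto> \<G>(S; SH, ST)\<close>, the energy \<open>E = \<kappa> * \<Phi>(S) + \<F>(S, p)\<^sup>2 / 2\<close> has derivative
  \<open>pc'(S) * \<F>\<^sup>2 / \<kappa> \<le> 0\<close> along solutions, where \<open>pc\<close> is \<open>pcd\<close> in the drainage
  region and \<open>pci\<close> in the imbibition region. The line through \<open>ST\<close> and \<open>SH\<close> lies below the graph
  of \<open>F\<close> on \<open>(ST, SH)\<close> and above it on \<open>(SB, ST)\<close> (\<open>convex_concave_sign\<close>), so \<open>\<Phi>\<close> is a potential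
  well on \<open>[SB, SH]\<close> with its bottom at \<open>ST\<close>.

  An orbit that leaves \<open>(SH, pcd SH)\<close> starts with energy \<open>\<kappa> * \<Phi>(SH)\<close> and can never climb back to
  \<open>SH\<close>. It cannot reach \<open>SB\<close> either, because \<open>\<Phi>(SB) > \<Phi>(SH)\<close>. This is where the definition of
  \<open>SH\<close> by the critical imbibition solution enters. For \<open>C = S_check \<tau>\<close> that solution \<open>u\<close> stays below
  \<open>pci\<close> on all of \<open>(SB, SH)\<close>, and the same energy computation along \<open>u\<close> shows that the integral of
  \<open>\<G>(S; SB, C)\<close> over \<open>[SB, SH]\<close> is not positive (\<open>imbibition_potential_drop\<close>). The chord from \<open>SB\<close>
  through \<open>C\<close> ends at \<open>SH = \<beta> C\<close> and runs below the line through \<open>ST\<close> and \<open>SH\<close>; hence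
  \<open>\<G>(S; SH, ST) < \<G>(S; SB, C)\<close> on \<open>(SB, SH)\<close>, and its integral is negative.

  The dynamics are treated in the locale \<open>hysteresis_system\<close>, which keeps only this potential-well
  picture. Clamping \<open>S\<close> to the well makes the vector field globally Lipschitz, so that solutions
  exist for all time and depend continuously on their values. The orbit emanating from the
  corner is the limit of solutions that start slightly above the corner and are recorded when they
  pass a fixed saturation; the passage times tend to infinity since the corner is an equilibrium
  (\<open>exists_backward_drainage_orbit\<close>). Convergence to the segment is LaSalle's argument
  (\<open>converges_to_equilibrium_segment\<close>): on a limit solution the energy is constant, so it
  rests in the hysteresis strip, where boundedness of the pressure leaves only \<open>S = ST\<close>.
\<close>

section \<open>Global solutions of Lipschitz differential equations\<close>

lemma continuous_has_primitive:
  fixes f :: "real \<Rightarrow> 'a::banach"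
  assumes "continuous_on UNIV f"
  shows "\<exists>P. P 0 = 0 \<and> (\<forall>t. (P has_vector_derivative f t) (at t))"
proof -
  define P where "P t = integral {0..t} f - integral {t..0} f" for t
  have int: "f integrable_on {u..v}" for u v
    using assms continuous_on_subset integrable_continuous_interval by blast
  have "(P has_vector_derivative f t) (at t)" for t
  proof -
    define T where "T = \<bar>t\<bar> + 1"
    have P: "P s = integral {-T..s} f - integral {-T..0} f" if "s \<in> {-T<..<T}" for s
    proof (cases "0 \<le> s")
      case True
      have "integral {-T..0} f + integral {0..s} f = integral {-T..s} f"
        by (rule Henstock_Kurzweil_Integration.integral_combine) (use that True int in \<open>auto simp: T_def\<close>)
      moreover have "integral {s..0} f = 0"
        using True by (cases "s = 0") auto
      ultimately show ?thesis by (simp add: P_def algebra_simps)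
    next
      case False
      have "integral {-T..s} f + integral {s..0} f = integral {-T..0} f"
        by (rule Henstock_Kurzweil_Integration.integral_combine) (use that False int in \<open>auto simp: T_def\<close>)
      with False show ?thesis by (simp add: P_def algebra_simps)
    qed
    have t: "t \<in> {-T<..<T}" by (auto simp: T_def)
    have "((\<lambda>s. integral {-T..s} f) has_vector_derivative f t) (at t within {-T..T})"
      using t by (intro integral_has_vector_derivative continuous_on_subset[OF assms]) auto
    hence "((\<lambda>s. integral {-T..s} f) has_vector_derivative f t) (at t)"
      using t at_within_interior[of t "{-T..T}"] by simp
    hence "((\<lambda>s. integral {-T..s} f - integral {-T..0} f) has_vector_derivative f t) (at t)"
      by (simp add: has_vector_derivative_diff_const)
    thus ?thesis
      by (rule has_vector_derivative_transform_within_open[of _ _ _ "{-T<..<T}"])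
         (use t P in auto)
  qed
  moreover have "P 0 = 0" by (simp add: P_def)
  ultimately show ?thesis by blast
qed

text \<open>Integrating the bound on the derivative gains the factor \<open>1 / l\<close>; this gain makes the
  integral operator of a differential equation a contraction in the weighted norm used below.\<close>

lemma norm_le_exp_if_derivative_le_exp:
  fixes y :: "real \<Rightarrow> 'a::banach"
  assumes "y 0 = 0" and y': "\<And>t. (y has_vector_derivative d t) (at t)"
    and d: "\<And>t. norm (d t) \<le> K * exp (l * \<bar>t\<bar>)" and l: "l > 0"
  shows "norm (y t) \<le> K / l * exp (l * \<bar>t\<bar>)"
proof -
  have K: "K \<ge> 0" using order_trans[OF norm_ge_zero d[of 0]] by simp
  have cont: "continuous_on A y" for A
    using y' by (meson has_vector_derivative_continuous continuous_at_imp_continuous_on)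
  consider "t = 0" | "t > 0" | "t < 0" by linarith
  thus ?thesis
  proof cases
    case 1
    thus ?thesis using K assms by simp
  next
    case 2
    have "norm (y t - y 0) \<le> K / l * exp (l * t) - K / l * exp (l * 0)"
    proof (rule differentiable_bound_general[where f' = d and \<phi>' = "\<lambda>s. K * exp (l * s)"])
      fix x :: real assume "0 < x" "x < t"
      show "((\<lambda>a. K / l * exp (l * a)) has_vector_derivative K * exp (l * x)) (at x)"
        unfolding has_real_derivative_iff_has_vector_derivative[symmetric]
        using \<open>l > 0\<close> by (auto intro!: derivative_eq_intros)
    next
      fix x :: real assume "0 < x" "x < t"
      thus "norm (d x) \<le> K * exp (l * x)" using d[of x] by simp
    qed (use 2 y' cont l in \<open>auto intro!: continuous_intros\<close>)
    moreover have "K / l \<ge> 0" using K \<open>l > 0\<close> by simp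
    ultimately show ?thesis using 2 assms(1) by simp
  next
    case 3
    have "norm (y 0 - y t) \<le> - K / l * exp (- l * 0) - (- K / l * exp (- l * t))"
    proof (rule differentiable_bound_general[where f' = d and \<phi>' = "\<lambda>s. K * exp (- l * s)"])
      fix x :: real assume "t < x" "x < 0"
      show "((\<lambda>a. - K / l * exp (- l * a)) has_vector_derivative K * exp (- l * x)) (at x)"
        unfolding has_real_derivative_iff_has_vector_derivative[symmetric]
        using \<open>l > 0\<close> by (auto intro!: derivative_eq_intros)
    next
      fix x :: real assume "t < x" "x < 0"
      thus "norm (d x) \<le> K * exp (- l * x)" using d[of x] by simp
    qed (use 3 y' cont l in \<open>auto intro!: continuous_intros\<close>)
    moreover have "K / l \<ge> 0" using K \<open>l > 0\<close> by simp
    ultimately show ?thesis using 3 assms(1) by simp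
  qed
qed

definition solves :: "('a::real_normed_vector \<Rightarrow> 'a) \<Rightarrow> (real \<Rightarrow> 'a) \<Rightarrow> bool" where
  "solves X x \<longleftrightarrow> (\<forall>t. (x has_vector_derivative X (x t)) (at t))"

text \<open>Banach's fixed point theorem for the integral equation, in the unknown
  \<open>u t = exp (- l * \<bar>t\<bar>) *\<^sub>R x t\<close>. The weight makes the solution bounded and, for \<open>l = 2 * L\<close>,
  the map a contraction with constant \<open>1 / 2\<close> on the whole real line at once, so that no gluing of
  local solutions is necessary.\<close>

lemma lipschitz_global_solution:
  fixes X :: "'a::banach \<Rightarrow> 'a"
  assumes lip: "L-lipschitz_on UNIV X" and L: "L > 0"
  shows "\<exists>x. solves X x \<and> x 0 = x0"
proof -
  define l where "l = 2 * L"
  have l: "l > 0" using L by (simp add: l_def)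
  \<comment> \<open>\<open>P f\<close> is the primitive of \<open>f\<close> that vanishes at \<open>0\<close>.\<close>
  obtain P :: "(real \<Rightarrow> 'a) \<Rightarrow> real \<Rightarrow> 'a" where P0: "\<And>f. continuous_on UNIV f \<Longrightarrow> P f 0 = 0"
    and P': "\<And>f t. continuous_on UNIV f \<Longrightarrow> (P f has_vector_derivative f t) (at t)"
  proof -
    have "\<forall>f::real \<Rightarrow> 'a. \<exists>P. continuous_on UNIV f \<longrightarrow> P 0 = 0 \<and> (\<forall>t. (P has_vector_derivative f t) (at t))"
      using continuous_has_primitive by blast
    thus ?thesis using that by metis
  qed
  define r where "r u s = X (exp (l * \<bar>s\<bar>) *\<^sub>R apply_bcontfun u s)" for u s
  have X: "continuous_on A X" for A
    using lip lipschitz_on_continuous_on continuous_on_subset by blast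
  have r: "continuous_on A (r u)" for A u
    unfolding r_def
    by (rule continuous_on_compose2[OF X[of UNIV]]) (auto intro!: continuous_intros)
  define T where "T u t = exp (- l * \<bar>t\<bar>) *\<^sub>R (x0 + P (r u) t)" for u t
  have Pbound: "norm (P (r u) t) \<le> (norm (X 0) + L * norm u) / l * exp (l * \<bar>t\<bar>)" for u t
  proof (rule norm_le_exp_if_derivative_le_exp[OF P0[OF r] P'[OF r] _ l])
    fix t
    have "norm (r u t) \<le> norm (X 0) + norm (r u t - X 0)"
      by norm
    also have "norm (r u t - X 0) \<le> L * norm (exp (l * \<bar>t\<bar>) *\<^sub>R apply_bcontfun u t)"
      unfolding r_def using lipschitz_on_normD[OF lip, of "exp (l * \<bar>t\<bar>) *\<^sub>R apply_bcontfun u t" 0] by simp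
    also have "\<dots> = L * exp (l * \<bar>t\<bar>) * norm (apply_bcontfun u t)" by simp
    also have "\<dots> \<le> L * exp (l * \<bar>t\<bar>) * norm u"
      using norm_bounded[of u t] L by (intro mult_left_mono) auto
    also have "norm (X 0) \<le> norm (X 0) * exp (l * \<bar>t\<bar>)"
      using l by (simp add: mult_le_cancel_left1)
    finally show "norm (r u t) \<le> (norm (X 0) + L * norm u) * exp (l * \<bar>t\<bar>)"
      by (simp add: algebra_simps)
  qed
  have Tb: "T u \<in> bcontfun" for u
  proof (rule bcontfun_normI)
    have "continuous_on UNIV (P (r u))"
      using P'[OF r] by (meson has_vector_derivative_continuous continuous_at_imp_continuous_on)
    thus "continuous_on UNIV (T u)" unfolding T_def by (intro continuous_intros)
    fix t
    have "norm (T u t) \<le> exp (- l * \<bar>t\<bar>) * (norm x0 + norm (P (r u) t))"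
      unfolding T_def by (simp add: norm_triangle_ineq)
    also have "\<dots> \<le> exp (- l * \<bar>t\<bar>) * (norm x0 * exp (l * \<bar>t\<bar>) + (norm (X 0) + L * norm u) / l * exp (l * \<bar>t\<bar>))"
      using l by (intro mult_left_mono add_mono Pbound) (auto simp: mult_le_cancel_left1)
    also have "\<dots> = norm x0 + (norm (X 0) + L * norm u) / l"
      by (simp add: exp_minus field_simps)
    finally show "norm (T u t) \<le> norm x0 + (norm (X 0) + L * norm u) / l" .
  qed
  have "\<exists>!u. Bcontfun (T u) = u"
  proof (rule banach_fix_type[where c = "1/2"])
    show "\<forall>u v. dist (Bcontfun (T u)) (Bcontfun (T v)) \<le> 1 / 2 * dist u v"
    proof (intro allI dist_bound)
      fix u v t
      define d where "d s = r u s - r v s" for s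
      have "norm (P (r u) t - P (r v) t) \<le> (L * dist u v) / l * exp (l * \<bar>t\<bar>)"
      proof (rule norm_le_exp_if_derivative_le_exp[where d = d])
        show "((\<lambda>t. P (r u) t - P (r v) t) has_vector_derivative d t) (at t)" for t
          unfolding d_def by (intro derivative_intros P' r)
        fix t
        have "norm (d t) \<le> L * norm (exp (l * \<bar>t\<bar>) *\<^sub>R (apply_bcontfun u t) - exp (l * \<bar>t\<bar>) *\<^sub>R (apply_bcontfun v t))"
          unfolding d_def r_def by (rule lipschitz_on_normD[OF lip]) auto
        also have "\<dots> = L * (exp (l * \<bar>t\<bar>) * dist (apply_bcontfun u t) (apply_bcontfun v t))"
          by (simp add: dist_norm flip: scaleR_diff_right)
        also have "\<dots> \<le> L * (exp (l * \<bar>t\<bar>) * dist u v)"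
          using L by (intro mult_left_mono dist_bounded) auto
        finally show "norm (d t) \<le> L * dist u v * exp (l * \<bar>t\<bar>)" by (simp add: algebra_simps)
      qed (use l P0 r in auto)
      hence "exp (- l * \<bar>t\<bar>) * norm (P (r u) t - P (r v) t)
          \<le> exp (- l * \<bar>t\<bar>) * ((L * dist u v) / l * exp (l * \<bar>t\<bar>))"
        by (intro mult_left_mono) auto
      also have "\<dots> = 1 / 2 * dist u v" using L by (simp add: l_def exp_minus field_simps)
      finally show "dist (apply_bcontfun (Bcontfun (T u)) t) (apply_bcontfun (Bcontfun (T v)) t) \<le> 1 / 2 * dist u v"
        by (simp add: Bcontfun_inverse Tb dist_norm T_def flip: scaleR_diff_right)
    qed
  qed auto
  then obtain u where "Bcontfun (T u) = u" by blast
  hence u: "apply_bcontfun u t = T u t" for t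
    using Bcontfun_inverse[OF Tb, of u] by metis
  define x where "x t = x0 + P (r u) t" for t
  have r_x: "r u t = X (x t)" for t
    by (simp add: r_def u T_def x_def exp_minus)
  have "(x has_vector_derivative X (x t)) (at t)" for t
    unfolding r_x[symmetric] unfolding x_def
    using has_vector_derivative_add[OF has_vector_derivative_const P'[OF r], of x0] by simp
  moreover have "x 0 = x0" by (simp add: x_def P0 r)
  ultimately show ?thesis unfolding solves_def by blast
qed

text \<open>Gronwall's estimate in both time directions: \<open>exp (\<mp> 2 * L * u) * (norm (x u - y u))\<^sup>2\<close> is
  nonincreasing, respectively nondecreasing, in \<open>u\<close>.\<close>

lemma norm_diff_solutions_le:
  fixes X :: "'a::real_inner \<Rightarrow> 'a"
  assumes lip: "L-lipschitz_on UNIV X" and x: "solves X x" and y: "solves X y"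
  shows "norm (x t - y t) \<le> exp (L * \<bar>t - s\<bar>) * norm (x s - y s)"
proof -
  define N where "N u = (x u - y u) \<bullet> (x u - y u)" for u
  define D where "D u = 2 * ((x u - y u) \<bullet> (X (x u) - X (y u)))" for u
  have N': "(N has_real_derivative D u) (at u)" for u
  proof -
    have "((\<lambda>u. x u - y u) has_vector_derivative (X (x u) - X (y u))) (at u)"
      using x y by (auto simp: solves_def intro!: derivative_intros)
    hence "((\<lambda>u. x u - y u) has_derivative (\<lambda>c. c *\<^sub>R (X (x u) - X (y u)))) (at u)"
      by (simp add: has_vector_derivative_def)
    from has_derivative_inner[OF this this]
    show ?thesis unfolding N_def D_def has_field_derivative_def
      by (rule has_derivative_eq_rhs) (auto simp: inner_commute algebra_simps)
  qed
  have D: "\<bar>D u\<bar> \<le> 2 * L * N u" for u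
  proof -
    have "\<bar>(x u - y u) \<bullet> (X (x u) - X (y u))\<bar> \<le> norm (x u - y u) * norm (X (x u) - X (y u))"
      by (rule Cauchy_Schwarz_ineq2)
    also have "\<dots> \<le> norm (x u - y u) * (L * norm (x u - y u))"
      by (intro mult_left_mono lipschitz_on_normD[OF lip]) auto
    finally show ?thesis
      by (simp add: D_def N_def abs_mult dot_square_norm power2_eq_square algebra_simps)
  qed
  have "N t \<le> exp (2 * L * \<bar>t - s\<bar>) * N s"
  proof (cases "s \<le> t")
    case True
    have "exp (- 2 * L * t) * N t \<le> exp (- 2 * L * s) * N s"
    proof (rule DERIV_nonpos_imp_nonincreasing[OF True])
      fix u
      have "((\<lambda>u. exp (- 2 * L * u) * N u) has_real_derivative
          exp (- 2 * L * u) * (D u - 2 * L * N u)) (at u)"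
        by (auto intro!: derivative_eq_intros N' simp: algebra_simps)
      moreover have "exp (- 2 * L * u) * (D u - 2 * L * N u) \<le> 0"
        using D[of u] by (intro mult_nonneg_nonpos) auto
      ultimately show "\<exists>z. ((\<lambda>u. exp (- 2 * L * u) * N u) has_real_derivative z) (at u) \<and> z \<le> 0"
        by blast
    qed
    hence "exp (2 * L * t) * (exp (- 2 * L * t) * N t) \<le> exp (2 * L * t) * (exp (- 2 * L * s) * N s)"
      by (intro mult_left_mono) auto
    moreover have "exp (2 * L * t) * (exp (- 2 * L * t) * N t) = N t"
      by (simp add: exp_minus)
    moreover have "exp (2 * L * \<bar>t - s\<bar>) = exp (2 * L * t) * exp (- 2 * L * s)"
      unfolding exp_add[symmetric] using True by (simp add: right_diff_distrib)
    ultimately show ?thesis by (metis mult.assoc)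
  next
    case False
    hence "t \<le> s" by simp
    have "exp (2 * L * t) * N t \<le> exp (2 * L * s) * N s"
    proof (rule DERIV_nonneg_imp_nondecreasing[OF \<open>t \<le> s\<close>])
      fix u
      have "((\<lambda>u. exp (2 * L * u) * N u) has_real_derivative
          exp (2 * L * u) * (D u + 2 * L * N u)) (at u)"
        by (auto intro!: derivative_eq_intros N' simp: algebra_simps)
      moreover have "exp (2 * L * u) * (D u + 2 * L * N u) \<ge> 0"
        using D[of u] by (intro mult_nonneg_nonneg) auto
      ultimately show "\<exists>z. ((\<lambda>u. exp (2 * L * u) * N u) has_real_derivative z) (at u) \<and> z \<ge> 0"
        by blast
    qed
    hence "exp (- 2 * L * t) * (exp (2 * L * t) * N t) \<le> exp (- 2 * L * t) * (exp (2 * L * s) * N s)"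
      by (intro mult_left_mono) auto
    moreover have "exp (- 2 * L * t) * (exp (2 * L * t) * N t) = N t"
      by (simp add: exp_minus)
    moreover have "exp (2 * L * \<bar>t - s\<bar>) = exp (- 2 * L * t) * exp (2 * L * s)"
      unfolding exp_add[symmetric] using False by (simp add: right_diff_distrib)
    ultimately show ?thesis by (metis mult.assoc)
  qed
  moreover have "exp (2 * L * \<bar>t - s\<bar>) = (exp (L * \<bar>t - s\<bar>))\<^sup>2"
    using exp_double[of "L * \<bar>t - s\<bar>"] by (simp only: mult.assoc)
  ultimately have "(norm (x t - y t))\<^sup>2 \<le> (exp (L * \<bar>t - s\<bar>) * norm (x s - y s))\<^sup>2"
    by (simp only: N_def dot_square_norm power_mult_distrib)
  thus ?thesis by (rule power2_le_imp_le) auto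
qed

lemma solves_shift: "solves X x \<Longrightarrow> solves X (\<lambda>t. x (s + t))"
  unfolding solves_def
proof (intro allI)
  fix t assume x: "\<forall>t. (x has_vector_derivative X (x t)) (at t)"
  have "((x \<circ> (\<lambda>t. s + t)) has_vector_derivative 1 *\<^sub>R X (x (s + t))) (at t)"
    by (rule vector_diff_chain_at) (use x in \<open>auto intro!: derivative_eq_intros\<close>)
  thus "((\<lambda>t. x (s + t)) has_vector_derivative X (x (s + t))) (at t)" by (simp add: o_def)
qed

lemma solutions_tendsto:
  fixes X :: "'a::real_inner \<Rightarrow> 'a"
  assumes lip: "L-lipschitz_on UNIV X" and x: "\<And>n. solves X (x n)" and z: "solves X z"
    and lim: "((\<lambda>n. x n (T n)) \<longlongrightarrow> z 0) A"
  shows "((\<lambda>n. x n (T n + t)) \<longlongrightarrow> z t) A"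
proof -
  have "norm (x n (T n + t) - z t) \<le> exp (L * \<bar>t\<bar>) * norm (x n (T n) - z 0)" for n
    using norm_diff_solutions_le[OF lip solves_shift[OF x[of n], of "T n"] z, of t 0] by simp
  moreover have "((\<lambda>n. exp (L * \<bar>t\<bar>) * norm (x n (T n) - z 0)) \<longlongrightarrow> 0) A"
    using lim by (intro tendsto_mult_right_zero tendsto_norm_zero) (simp add: LIM_zero_iff)
  ultimately have "((\<lambda>n. x n (T n + t) - z t) \<longlongrightarrow> 0) A"
    by (rule Lim_null_comparison[OF always_eventually[OF allI]])
  thus ?thesis by (simp add: LIM_zero_iff)
qed

text \<open>The solution through the limit point is, by continuous dependence, the limit of the time shifts
  of \<open>x\<close>; these all have the same limit, so it is constant. The filter \<open>A\<close> is \<open>at_top\<close> or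
  \<open>at_bot\<close> below.\<close>

lemma limit_of_solution_is_equilibrium:
  fixes X :: "'a::{banach,real_inner} \<Rightarrow> 'a"
  assumes lip: "L-lipschitz_on UNIV X" and L: "L > 0" and x: "solves X x"
    and lim: "(x \<longlongrightarrow> e) A" and A: "A \<noteq> bot"
    and shift: "\<And>t. filterlim (\<lambda>s. s + t) A A"
  shows "X e = 0"
proof -
  obtain z where z: "solves X z" "z 0 = e"
    using lipschitz_global_solution[OF lip L] by blast
  have "z t = e" for t
  proof (rule tendsto_unique[OF A])
    show "((\<lambda>s. x (s + t)) \<longlongrightarrow> z t) A"
      using solutions_tendsto[OF lip x z(1), of "\<lambda>s. s" A t] lim z(2) by simp
    show "((\<lambda>s. x (s + t)) \<longlongrightarrow> e) A"
      using filterlim_compose[OF lim shift] .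
  qed
  hence "z = (\<lambda>t. e)" by auto
  with z(1) have "((\<lambda>t. e) has_vector_derivative X e) (at 0)" by (auto simp: solves_def)
  thus ?thesis using has_vector_derivative_const vector_derivative_unique_at by blast
qed

section \<open>Auxiliary facts on real functions\<close>

lemma nondecreasing_bounded_below_converges_at_bot:
  fixes f :: "real \<Rightarrow> real"
  assumes mono: "\<And>s t. s \<le> t \<Longrightarrow> t \<le> 0 \<Longrightarrow> f s \<le> f t" and bd: "\<And>t. t \<le> 0 \<Longrightarrow> c \<le> f t"
  shows "\<exists>l. (f \<longlongrightarrow> l) at_bot"
proof -
  have bb: "bdd_below (f ` {..0})" using bd by (auto intro!: bdd_belowI[of _ c])
  have "(f \<longlongrightarrow> Inf (f ` {..0})) at_bot"
  proof (rule order_tendstoI)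
    fix y assume "y < Inf (f ` {..0})"
    hence "\<forall>t\<le>0. y < f t" using cInf_lower[OF _ bb] by (meson atMost_iff imageI less_le_trans)
    thus "\<forall>\<^sub>F t in at_bot. y < f t" unfolding eventually_at_bot_linorder by blast
  next
    fix y assume "Inf (f ` {..0}) < y"
    then obtain s where "s \<le> 0" "f s < y" using cInf_lessD[of "f ` {..0}" y] by auto
    hence "\<forall>t\<le>s. f t < y" using mono by (meson order.strict_trans1)
    thus "\<forall>\<^sub>F t in at_bot. f t < y" unfolding eventually_at_bot_linorder by blast
  qed
  thus ?thesis by blast
qed

lemma lipschitz_on_positive_part:
  fixes f :: "'a::metric_space \<Rightarrow> real"
  assumes "C-lipschitz_on U f"
  shows "C-lipschitz_on U (\<lambda>x. max (f x) 0)"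
proof (rule lipschitz_onI)
  fix x y assume "x \<in> U" "y \<in> U"
  hence "dist (f x) (f y) \<le> C * dist x y" using assms lipschitz_onD by blast
  moreover have "dist (max (f x) 0) (max (f y) 0) \<le> dist (f x) (f y)"
    by (auto simp: dist_real_def max_def)
  ultimately show "dist (max (f x) 0) (max (f y) 0) \<le> C * dist x y" by linarith
qed (use assms lipschitz_on_nonneg in blast)

lemma positive_part_squared_has_derivative:
  "((\<lambda>x::real. (max x 0)\<^sup>2) has_real_derivative 2 * max x 0) (at x)"
proof -
  consider "x > 0" | "x < 0" | "x = 0" by linarith
  thus ?thesis
  proof cases
    case 1
    have "((\<lambda>x::real. x\<^sup>2) has_real_derivative 2 * max x 0) (at x)"
      using 1 by (auto intro!: derivative_eq_intros)
    thus ?thesis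
      by (rule DERIV_cong_ev[THEN iffD1, rotated -1])
         (use 1 eventually_nhds_in_open[of "{0<..}" x] in \<open>auto elim!: eventually_mono simp: max_def\<close>)
  next
    case 2
    have "((\<lambda>x::real. 0) has_real_derivative 2 * max x 0) (at x)" using 2 by auto
    thus ?thesis
      by (rule DERIV_cong_ev[THEN iffD1, rotated -1])
         (use 2 eventually_nhds_in_open[of "{..<0}" x] in \<open>auto elim!: eventually_mono simp: max_def\<close>)
  next
    case 3
    have "((\<lambda>h. ((max (0 + h) 0)\<^sup>2 - (max 0 0)\<^sup>2) / h) \<longlongrightarrow> 0) (at (0::real))"
    proof (rule Lim_null_comparison)
      show "\<forall>\<^sub>F h in at 0. norm (((max (0 + h) 0)\<^sup>2 - (max 0 0)\<^sup>2) / h) \<le> \<bar>h\<bar>"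
        by (rule always_eventually) (auto simp: max_def power2_eq_square)
      show "((\<lambda>h::real. \<bar>h\<bar>) \<longlongrightarrow> 0) (at 0)" by (rule tendsto_eq_intros | simp)+
    qed
    thus ?thesis using 3 by (simp add: DERIV_def)
  qed
qed

lemma first_time_at_level:
  fixes f :: "real \<Rightarrow> real"
  assumes cont: "continuous_on {0..T} f" and "0 \<le> T" and f0: "c < f 0" and fT: "f T \<le> c"
  obtains t where "t \<in> {0<..T}" "f t = c" "\<And>u. u \<in> {0..<t} \<Longrightarrow> c < f u"
proof -
  define Z where "Z = {0..T} \<inter> f -` {..c}"
  have "closed Z" unfolding Z_def by (intro continuous_closed_preimage cont) auto
  hence "compact Z" unfolding Z_def
    using compact_Int_closed[OF compact_Icc[of 0 T], of Z] by (simp add: Z_def)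
  moreover have "T \<in> Z" using fT \<open>0 \<le> T\<close> by (auto simp: Z_def)
  ultimately obtain t where t: "t \<in> Z" and min: "\<And>u. u \<in> Z \<Longrightarrow> t \<le> u"
    using compact_attains_inf[of Z] by blast
  obtain u where u: "0 \<le> u" "u \<le> t" "f u = c"
    using IVT2'[of f t c 0] t f0 continuous_on_subset[OF cont, of "{0..t}"] by (auto simp: Z_def)
  hence "u \<in> Z" using t by (auto simp: Z_def)
  hence "f t = c" using u min[of u] by simp
  moreover from this have "t > 0" using t f0 by (cases "t = 0") (auto simp: Z_def)
  moreover have "c < f u" if "u \<in> {0..<t}" for u
    using min[of u] that t by (auto simp: Z_def not_le[symmetric])
  ultimately show ?thesis using that[of t] t by (auto simp: Z_def)
qed

lemma filterlim_shift_at_bot: "filterlim (\<lambda>s::real. s + t) at_bot at_bot"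
  unfolding filterlim_at_bot eventually_at_bot_linorder
  by (intro allI) (rule_tac x = "Z - t" in exI, auto)

lemma filterlim_shift_at_top: "filterlim (\<lambda>s::real. s + t) at_top at_top"
  unfolding filterlim_at_top eventually_at_top_linorder
  by (intro allI) (rule_tac x = "Z - t" in exI, auto)

section \<open>Play-type hysteresis in a potential well\<close>

text \<open>The essential features of the travelling wave system: the saturation moves in a well
  \<open>[a, b]\<close> of the potential \<open>\<Phi>\<close> with its bottom at \<open>m\<close> and its lower rim at \<open>b\<close>; \<open>qi\<close> and \<open>qd\<close> are
  the imbibition and drainage curves, \<open>g = \<Phi>'\<close> is the rate of change of the pressure, and \<open>k\<close> is the
  relaxation constant \<open>c_d * \<tau>\<close>.\<close>

locale hysteresis_system =
  fixes a m b k :: real and qi qd g \<Phi> :: "real \<Rightarrow> real"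
  assumes am: "a < m" and mb: "m < b" and k: "k > 0"
    and lip_qi: "\<exists>L. L-lipschitz_on {a..b} qi"
    and lip_qd: "\<exists>L. L-lipschitz_on {a..b} qd"
    and lip_g: "\<exists>L. L-lipschitz_on {a..b} g"
    and qi_decr: "\<And>s. s \<in> {a<..<b} \<Longrightarrow> \<exists>D<0. (qi has_real_derivative D) (at s)"
    and qd_decr: "\<And>s. s \<in> {a<..<b} \<Longrightarrow> \<exists>D<0. (qd has_real_derivative D) (at s)"
    and qi_le_qd: "\<And>s. s \<in> {a..b} \<Longrightarrow> qi s \<le> qd s"
    and g_b: "g b = 0"
    and g_neg: "\<And>s. s \<in> {a<..<m} \<Longrightarrow> g s < 0"
    and g_pos: "\<And>s. s \<in> {m<..<b} \<Longrightarrow> 0 < g s"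
    and cont_\<Phi>: "continuous_on {a..b} \<Phi>"
    and \<Phi>': "\<And>s. s \<in> {a<..<b} \<Longrightarrow> (\<Phi> has_real_derivative g s) (at s)"
    and \<Phi>_ends: "\<Phi> b < \<Phi> a"
begin

definition clamp_ab :: "real \<Rightarrow> real" where "clamp_ab s = max a (min b s)"

text \<open>The positive and the negative part of \<open>\<F>\<close>: at most one of the two is nonzero, and
  \<open>\<F> = imb - dra\<close>. Written in this way \<open>\<F>\<close> is visibly Lipschitz, and the squares of both parts
  are differentiable.\<close>

definition imb :: "real \<Rightarrow> real \<Rightarrow> real" where "imb s p = max (qi s - p) 0"

definition dra :: "real \<Rightarrow> real \<Rightarrow> real" where "dra s p = max (p - qd s) 0"

text \<open>On the strip \<open>a \<le> S \<le> b\<close> this is the right-hand side of the travelling wave system; clamping the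
  saturation continues it to a globally Lipschitz field on the plane.\<close>

definition velocity :: "real \<times> real \<Rightarrow> real \<times> real" where
  "velocity z = ((imb (clamp_ab (fst z)) (snd z) - dra (clamp_ab (fst z)) (snd z)) / k, g (clamp_ab (fst z)))"

definition energy :: "real \<times> real \<Rightarrow> real" where
  "energy z = k * \<Phi> (fst z) + ((imb (fst z) (snd z))\<^sup>2 + (dra (fst z) (snd z))\<^sup>2) / 2"

lemma ab: "a < b" using am mb by simp

lemma clamp_in: "clamp_ab s \<in> {a..b}" using ab by (auto simp: clamp_ab_def)

lemma clamp_id: "s \<in> {a..b} \<Longrightarrow> clamp_ab s = s" by (auto simp: clamp_ab_def)

lemma cont_q: "continuous_on {a..b} qi" "continuous_on {a..b} qd" "continuous_on {a..b} g"
  using lip_qi lip_qd lip_g lipschitz_on_continuous_on by blast+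

lemma velocity_lipschitz: "\<exists>L>0. L-lipschitz_on UNIV velocity"
proof -
  have cl: "1-lipschitz_on UNIV (\<lambda>z::real\<times>real. clamp_ab (fst z))"
  proof (rule lipschitz_onI)
    fix z w :: "real \<times> real"
    have "dist (clamp_ab (fst z)) (clamp_ab (fst w)) \<le> dist (fst z) (fst w)"
      by (auto simp: clamp_ab_def dist_real_def max_def min_def)
    also have "\<dots> \<le> dist z w" by (rule dist_fst_le)
    finally show "dist (clamp_ab (fst z)) (clamp_ab (fst w)) \<le> 1 * dist z w" by simp
  qed auto
  have comp: "\<exists>C. C-lipschitz_on UNIV (\<lambda>z::real\<times>real. f (clamp_ab (fst z)))"
    if "\<exists>L. L-lipschitz_on {a..b} f" for f :: "real \<Rightarrow> real"
    using that lipschitz_on_compose2[OF cl] lipschitz_on_subset clamp_in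
    by (metis (mono_tags, lifting) image_subset_iff)
  have snd: "1-lipschitz_on UNIV (snd :: real \<times> real \<Rightarrow> real)"
    by (rule lipschitz_onI) (auto simp: dist_snd_le)
  obtain Ci Cd Cg where C: "Ci-lipschitz_on UNIV (\<lambda>z::real\<times>real. qi (clamp_ab (fst z)))"
      "Cd-lipschitz_on UNIV (\<lambda>z::real\<times>real. qd (clamp_ab (fst z)))"
      "Cg-lipschitz_on UNIV (\<lambda>z::real\<times>real. g (clamp_ab (fst z)))"
    using comp lip_qi lip_qd lip_g by meson
  have "(Ci + 1)-lipschitz_on UNIV (\<lambda>z::real\<times>real. imb (clamp_ab (fst z)) (snd z))"
    unfolding imb_def by (intro lipschitz_on_positive_part lipschitz_on_diff C snd)
  moreover have "(1 + Cd)-lipschitz_on UNIV (\<lambda>z::real\<times>real. dra (clamp_ab (fst z)) (snd z))"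
    unfolding dra_def by (intro lipschitz_on_positive_part lipschitz_on_diff C snd)
  ultimately have "((Ci + 1) + (1 + Cd))-lipschitz_on UNIV
      (\<lambda>z::real\<times>real. imb (clamp_ab (fst z)) (snd z) - dra (clamp_ab (fst z)) (snd z))"
    by (rule lipschitz_on_diff)
  hence "(\<bar>1 / k\<bar> * ((Ci + 1) + (1 + Cd)))-lipschitz_on UNIV
      (\<lambda>z::real\<times>real. 1 / k * (imb (clamp_ab (fst z)) (snd z) - dra (clamp_ab (fst z)) (snd z)))"
    by (rule lipschitz_on_cmult_real)
  from lipschitz_on_Pair[OF this C(3)] obtain L where "L-lipschitz_on UNIV velocity"
    unfolding velocity_def by (auto simp: field_simps)
  hence "(\<bar>L\<bar> + 1)-lipschitz_on UNIV velocity" by (rule lipschitz_on_mono) auto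
  thus ?thesis by (intro exI[of _ "\<bar>L\<bar> + 1"]) auto
qed

lemma exists_solution: "\<exists>x. solves velocity x \<and> x 0 = z"
  using velocity_lipschitz lipschitz_global_solution by blast

lemma solution_components:
  assumes "solves velocity x"
  shows "((\<lambda>t. fst (x t)) has_real_derivative fst (velocity (x t))) (at t)"
    and "((\<lambda>t. snd (x t)) has_real_derivative snd (velocity (x t))) (at t)"
  using assms bounded_linear.has_vector_derivative[OF bounded_linear_fst]
    bounded_linear.has_vector_derivative[OF bounded_linear_snd]
  unfolding solves_def has_real_derivative_iff_has_vector_derivative by blast+

lemma solution_continuous: "solves velocity x \<Longrightarrow> continuous_on A x"
  unfolding solves_def by (meson has_vector_derivative_continuous continuous_at_imp_continuous_on)

lemma continuous_energy: "continuous_on ({a..b} \<times> UNIV) energy"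
  unfolding energy_def imb_def dra_def
  by (intro continuous_intros continuous_on_compose2[OF cont_\<Phi>] continuous_on_compose2[OF cont_q(1)]
      continuous_on_compose2[OF cont_q(2)]) auto

text \<open>The conservative terms cancel since \<open>k * S' = imb - dra\<close> and \<open>p' = g\<close>. What remains is
  \<open>(imb\<^sup>2 * qi' + dra\<^sup>2 * qd') / k\<close>, because \<open>imb * dra = 0\<close>; it is the monotonicity of
  the pressure curves that damps the motion.\<close>

lemma energy_derivative:
  assumes x: "solves velocity x" and S: "fst (x t) \<in> {a<..<b}"
  shows "\<exists>D. ((\<lambda>t. energy (x t)) has_real_derivative D) (at t) \<and> D \<le> 0 \<and>
    (D = 0 \<longrightarrow> imb (fst (x t)) (snd (x t)) = 0 \<and> dra (fst (x t)) (snd (x t)) = 0)"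
proof -
  obtain Di Dd where D: "Di < 0" "(qi has_real_derivative Di) (at (fst (x t)))"
      "Dd < 0" "(qd has_real_derivative Dd) (at (fst (x t)))"
    using qi_decr[OF S] qd_decr[OF S] by blast
  define u where "u = imb (fst (x t)) (snd (x t))"
  define d where "d = dra (fst (x t)) (snd (x t))"
  have cl: "clamp_ab (fst (x t)) = fst (x t)" using S by (intro clamp_id) auto
  have f: "velocity (x t) = ((u - d) / k, g (fst (x t)))"
    by (simp add: velocity_def cl u_def d_def)
  note S' = solution_components(1)[OF x, of t, unfolded f, simplified]
  note p' = solution_components(2)[OF x, of t, unfolded f, simplified]
  have i': "((\<lambda>t. qi (fst (x t)) - snd (x t)) has_real_derivative Di * ((u - d) / k) - g (fst (x t))) (at t)"
    by (intro DERIV_diff DERIV_chain2[where f = qi, OF D(2) S'] p')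
  have d': "((\<lambda>t. snd (x t) - qd (fst (x t))) has_real_derivative g (fst (x t)) - Dd * ((u - d) / k)) (at t)"
    by (intro DERIV_diff DERIV_chain2[where f = qd, OF D(4) S'] p')
  have sq: "((\<lambda>t. (imb (fst (x t)) (snd (x t)))\<^sup>2) has_real_derivative
         2 * u * (Di * ((u - d) / k) - g (fst (x t)))) (at t)"
      "((\<lambda>t. (dra (fst (x t)) (snd (x t)))\<^sup>2) has_real_derivative
         2 * d * (g (fst (x t)) - Dd * ((u - d) / k))) (at t)"
    unfolding imb_def dra_def u_def d_def
    using DERIV_chain2[OF positive_part_squared_has_derivative i']
      DERIV_chain2[OF positive_part_squared_has_derivative d']
    by (simp_all add: imb_def dra_def u_def d_def)
  have ud: "u * d = 0" using qi_le_qd[of "fst (x t)"] S by (auto simp: u_def d_def imb_def dra_def max_def)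
  define R where "R = (u\<^sup>2 * Di + d\<^sup>2 * Dd) / k"
  have "((\<lambda>t. energy (x t)) has_real_derivative
      k * (g (fst (x t)) * ((u - d) / k)) + (2 * u * (Di * ((u - d) / k) - g (fst (x t)))
        + 2 * d * (g (fst (x t)) - Dd * ((u - d) / k))) / 2) (at t)"
    unfolding energy_def
    by (intro DERIV_add DERIV_cmult DERIV_cdivide sq DERIV_chain2[OF \<Phi>'[OF S] S'])
  also have "k * (g (fst (x t)) * ((u - d) / k)) + (2 * u * (Di * ((u - d) / k) - g (fst (x t)))
        + 2 * d * (g (fst (x t)) - Dd * ((u - d) / k))) / 2 = R"
    using ud k by (auto simp: R_def field_simps power2_eq_square)
  finally have "((\<lambda>t. energy (x t)) has_real_derivative R) (at t)" .
  moreover have "R \<le> 0"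
    using D k unfolding R_def by (intro divide_nonpos_pos add_nonpos_nonpos mult_nonneg_nonpos) auto
  moreover have "u = 0 \<and> d = 0" if "R = 0"
  proof -
    have "u\<^sup>2 * Di + d\<^sup>2 * Dd = 0" using that k by (simp add: R_def)
    moreover have "u\<^sup>2 * Di \<le> 0" "d\<^sup>2 * Dd \<le> 0" using D by (auto intro: mult_nonneg_nonpos)
    ultimately have "u\<^sup>2 * Di = 0" "d\<^sup>2 * Dd = 0" by linarith+
    thus ?thesis using D by auto
  qed
  ultimately show ?thesis unfolding u_def d_def by blast
qed

lemma energy_along_continuous:
  assumes "solves velocity x" and "\<And>u. u \<in> A \<Longrightarrow> fst (x u) \<in> {a..b}"
  shows "continuous_on A (\<lambda>t. energy (x t))"
  by (rule continuous_on_compose2[OF continuous_energy solution_continuous[OF assms(1)]])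
     (use assms(2) in \<open>auto simp: image_subset_iff mem_Times_iff\<close>)

lemma energy_nonincreasing:
  assumes x: "solves velocity x" and "s \<le> t"
    and inside: "\<And>u. u \<in> {s<..<t} \<Longrightarrow> fst (x u) \<in> {a<..<b}"
    and ends: "fst (x s) \<in> {a..b}" "fst (x t) \<in> {a..b}"
  shows "energy (x t) \<le> energy (x s)"
proof (rule DERIV_nonpos_imp_decreasing_open[OF \<open>s \<le> t\<close>])
  show "continuous_on {s..t} (\<lambda>t. energy (x t))"
  proof (rule energy_along_continuous[OF x])
    fix u assume "u \<in> {s..t}"
    thus "fst (x u) \<in> {a..b}" using inside[of u] ends by (cases "u = s \<or> u = t") auto
  qed
qed (use energy_derivative[OF x inside] in auto)

text \<open>A linear bound by the energy suffices here; it comes from \<open>v \<le> (v\<^sup>2 + 1) / 2\<close>.\<close>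

lemma pressure_bounded_by_energy: "\<exists>C. \<forall>z. fst z \<in> {a..b} \<longrightarrow> \<bar>snd z\<bar> \<le> C + energy z"
proof -
  have bd: "\<exists>B. \<forall>s\<in>{a..b}. \<bar>f s\<bar> \<le> B" if "continuous_on {a..b} f" for f :: "real \<Rightarrow> real"
    using compact_imp_bounded[OF compact_continuous_image[OF that compact_Icc]]
    unfolding bounded_iff by auto
  obtain Bi Bd B\<Phi> where B: "\<forall>s\<in>{a..b}. \<bar>qi s\<bar> \<le> Bi" "\<forall>s\<in>{a..b}. \<bar>qd s\<bar> \<le> Bd" "\<forall>s\<in>{a..b}. \<bar>\<Phi> s\<bar> \<le> B\<Phi>"
    using bd cont_q cont_\<Phi> by meson
  have "\<bar>snd z\<bar> \<le> (Bi + Bd + k * B\<Phi> + 1) + energy z" if z: "fst z \<in> {a..b}" for z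
  proof -
    define u where "u = imb (fst z) (snd z)"
    define d where "d = dra (fst z) (snd z)"
    have "u \<le> (u\<^sup>2 + 1) / 2" "d \<le> (d\<^sup>2 + 1) / 2"
      using zero_le_power2[of "u - 1"] zero_le_power2[of "d - 1"] by (auto simp: power2_eq_square algebra_simps)
    moreover have "0 \<le> u\<^sup>2" "0 \<le> d\<^sup>2" by simp_all
    moreover have "k * \<Phi> (fst z) \<ge> - (k * B\<Phi>)"
      using B(3) z k by (metis abs_le_D2 minus_le_iff mult_minus_right mult_left_mono less_imp_le)
    moreover have "energy z = k * \<Phi> (fst z) + (u\<^sup>2 + d\<^sup>2) / 2" by (simp add: energy_def u_def d_def)
    moreover have "u \<ge> 0" "d \<ge> 0" "u \<ge> qi (fst z) - snd z" "d \<ge> snd z - qd (fst z)"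
      by (auto simp: u_def d_def imb_def dra_def)
    moreover have "\<bar>qi (fst z)\<bar> \<le> Bi" "\<bar>qd (fst z)\<bar> \<le> Bd" using B z by auto
    ultimately show ?thesis by argo
  qed
  thus ?thesis by blast
qed

subsection \<open>The orbit emanating from the drainage corner\<close>

lemma velocity_drainage:
  assumes "fst z \<in> {a..b}" "qd (fst z) \<le> snd z"
  shows "velocity z = ((qd (fst z) - snd z) / k, g (fst z))"
  using assms qi_le_qd[OF assms(1)] by (simp add: velocity_def clamp_id imb_def dra_def)

text \<open>On the drainage curve \<open>S' = 0\<close> while \<open>p' = g > 0\<close> to the right of \<open>m\<close>, so the curve is crossed
  only from below. Hence an orbit in the drainage region cannot leave it before the saturation has
  dropped to \<open>m\<close>.\<close>

lemma pressure_rises_through_drainage_curve: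
  assumes x: "solves velocity x" and S: "fst (x t) \<in> {m<..<b}" and p: "snd (x t) = qd (fst (x t))"
  shows "\<exists>d>0. \<forall>h>0. h < d \<longrightarrow> snd (x (t - h)) < qd (fst (x (t - h)))"
proof -
  have S': "fst (x t) \<in> {a<..<b}" using S am by auto
  then obtain D where D: "(qd has_real_derivative D) (at (fst (x t)))" using qd_decr by blast
  have f: "velocity (x t) = (0, g (fst (x t)))"
    using S' p by (subst velocity_drainage) auto
  have "((\<lambda>t. snd (x t) - qd (fst (x t))) has_real_derivative g (fst (x t)) - D * 0) (at t)"
    using solution_components[OF x, of t] unfolding f
    by (intro DERIV_diff DERIV_chain2[where f = qd and g = "\<lambda>t. fst (x t)", OF D]) auto
  hence "\<exists>d>0. \<forall>h>0. h < d \<longrightarrow> snd (x (t - h)) - qd (fst (x (t - h))) < snd (x t) - qd (fst (x t))"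
    using g_pos[OF S] by (intro DERIV_pos_inc_left) auto
  thus ?thesis using p by simp
qed

lemma continuous_clamp: "continuous_on A f \<Longrightarrow> continuous_on A (\<lambda>t. clamp_ab (f t))"
  unfolding clamp_ab_def by (intro continuous_intros)

lemma saturation_strictly_decreasing:
  assumes x: "solves velocity x" and "s < t"
    and p: "\<And>u. u \<in> {s<..<t} \<Longrightarrow> qd (clamp_ab (fst (x u))) < snd (x u)"
  shows "fst (x t) < fst (x s)"
proof (rule DERIV_neg_imp_decreasing_open[OF \<open>s < t\<close>])
  show "continuous_on {s..t} (\<lambda>u. fst (x u))"
    by (intro continuous_intros solution_continuous x)
  fix u assume "s < u" "u < t"
  hence "fst (velocity (x u)) < 0"
    using p[of u] qi_le_qd[OF clamp_in, of "fst (x u)"] k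
    by (simp add: velocity_def imb_def dra_def divide_neg_pos)
  thus "\<exists>D. ((\<lambda>u. fst (x u)) has_real_derivative D) (at u) \<and> D < 0"
    using solution_components(1)[OF x] by blast
qed

lemma drainage_monotone:
  assumes x: "solves velocity x" and "s \<le> t"
    and S: "\<And>u. u \<in> {s..t} \<Longrightarrow> fst (x u) \<in> {m<..b}"
    and p: "\<And>u. u \<in> {s..t} \<Longrightarrow> qd (fst (x u)) \<le> snd (x u)"
  shows "fst (x t) \<le> fst (x s)" "snd (x s) \<le> snd (x t)"
proof -
  have f: "velocity (x u) = ((qd (fst (x u)) - snd (x u)) / k, g (fst (x u)))" if "u \<in> {s..t}" for u
    using S[OF that] p[OF that] am by (intro velocity_drainage) auto
  show "fst (x t) \<le> fst (x s)"
  proof (rule DERIV_nonpos_imp_nonincreasing[OF \<open>s \<le> t\<close>])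
    fix u assume "s \<le> u" "u \<le> t"
    hence "fst (velocity (x u)) \<le> 0" using f[of u] p[of u] k by (simp add: divide_nonpos_pos)
    thus "\<exists>D. ((\<lambda>u. fst (x u)) has_real_derivative D) (at u) \<and> D \<le> 0"
      using solution_components(1)[OF x] by blast
  qed
  show "snd (x s) \<le> snd (x t)"
  proof (rule DERIV_nonneg_imp_nondecreasing[OF \<open>s \<le> t\<close>])
    fix u assume "s \<le> u" "u \<le> t"
    hence "snd (velocity (x u)) \<ge> 0"
      using f[of u] S[of u] g_pos[of "fst (x u)"] g_b by (cases "fst (x u) = b") auto
    thus "\<exists>D. ((\<lambda>u. snd (x u)) has_real_derivative D) (at u) \<and> D \<ge> 0"
      using solution_components(2)[OF x] by blast
  qed
qed

text \<open>At a first time on the drainage curve the pressure would have been below the curve just before.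
  The function \<open>y\<close> is built with \<open>clamp_ab\<close> since \<open>fst (x t) \<le> b\<close> is part of what has to be shown; it
  follows from \<open>y > 0\<close>, which makes the saturation decrease.\<close>

lemma stays_in_drainage_region:
  assumes x: "solves velocity x" and x0: "fst (x 0) = b" "qd b < snd (x 0)"
    and S: "\<And>t. t \<in> {0..T} \<Longrightarrow> m < fst (x t)" and t: "t \<in> {0..T}"
  shows "fst (x t) \<le> b \<and> qd (fst (x t)) < snd (x t)"
proof -
  define y where "y t = snd (x t) - qd (clamp_ab (fst (x t)))" for t
  have y: "continuous_on A y" for A
    unfolding y_def using clamp_in
    by (intro continuous_intros solution_continuous x continuous_on_compose2[OF cont_q(2)] continuous_clamp)
       blast
  have decr: "fst (x v) < b" if "v > 0" "\<And>u. u \<in> {0..<v} \<Longrightarrow> y u > 0" for v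
  proof -
    have "fst (x v) < fst (x 0)"
    proof (rule saturation_strictly_decreasing[OF x that(1)])
      fix u assume "u \<in> {0<..<v}"
      thus "qd (clamp_ab (fst (x u))) < snd (x u)" using that(2)[of u] by (simp add: y_def)
    qed
    thus ?thesis using x0 by simp
  qed
  have pos: "y t > 0" if "t \<in> {0..T}" for t
  proof (rule ccontr)
    assume "\<not> y t > 0"
    moreover have "y 0 > 0" using x0 ab by (simp add: y_def clamp_id)
    ultimately obtain v where v: "v \<in> {0<..t}" "y v = 0" "\<And>u. u \<in> {0..<v} \<Longrightarrow> y u > 0"
      using first_time_at_level[OF y, of t 0] \<open>t \<in> {0..T}\<close> by auto
    have "fst (x v) < b" using v by (intro decr) auto
    moreover have "m < fst (x v)" using S v(1) that by auto
    ultimately have S_v: "fst (x v) \<in> {m<..<b}" by simp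
    have "snd (x v) = qd (fst (x v))" using v(2) S_v am by (simp add: y_def clamp_id)
    then obtain d where d: "d > 0" "\<forall>h>0. h < d \<longrightarrow> snd (x (v - h)) < qd (fst (x (v - h)))"
      using pressure_rises_through_drainage_curve[OF x S_v] by blast
    define h where "h = min d v / 2"
    have h: "h > 0" "h < d" "h < v" using d v(1) by (auto simp: h_def min_def)
    have "fst (x (v - h)) < b" using v h by (intro decr) auto
    moreover have "m < fst (x (v - h))" using S[of "v - h"] v(1) that h by auto
    ultimately have "y (v - h) < 0" using d h am by (simp add: y_def clamp_id)
    with v(3)[of "v - h"] h show False by auto
  qed
  have "fst (x t) \<le> b"
  proof (cases "t = 0")
    case False
    thus ?thesis using t pos by (intro less_imp_le decr) auto
  qed (use x0 in simp)
  moreover from this have "qd (fst (x t)) < snd (x t)"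
    using pos[OF t] S[OF t] am by (simp add: y_def clamp_id)
  ultimately show ?thesis by simp
qed

text \<open>An orbit that stayed above \<open>s0\<close> for ever would be monotone in both components and bounded, the
  pressure being controlled by the energy. It would converge to an equilibrium with saturation in
  \<open>[s0, b)\<close>, where \<open>g\<close> has no zero.\<close>

lemma reaches_saturation:
  assumes x: "solves velocity x" and x0: "fst (x 0) = b" "qd b < snd (x 0)" and s0: "s0 \<in> {m<..<b}"
  shows "\<exists>T\<ge>0. fst (x T) = s0 \<and> energy (x T) \<le> energy (x 0) \<and>
    (\<forall>t\<in>{0..T}. fst (x t) \<in> {s0..b} \<and> qd (fst (x t)) \<le> snd (x t))"
proof -
  have drain: "fst (x t) \<in> {m<..b} \<and> qd (fst (x t)) < snd (x t) \<and> energy (x t) \<le> energy (x 0) \<and> (0 < t \<longrightarrow> fst (x t) < b)"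
    if "\<And>t. t \<in> {0..T} \<Longrightarrow> m < fst (x t)" "t \<in> {0..T}" for t T
  proof -
    have st: "m < fst (x u)" "fst (x u) \<le> b" "qd (fst (x u)) < snd (x u)" if "u \<in> {0..T}" for u
      using stays_in_drainage_region[OF x x0 _ that] \<open>\<And>t. t \<in> {0..T} \<Longrightarrow> m < fst (x t)\<close> that by blast+
    have lt: "fst (x u) < b" if "0 < u" "u \<le> T" for u
    proof -
      have "fst (x u) < fst (x 0)"
      proof (rule saturation_strictly_decreasing[OF x that(1)])
        fix v assume "v \<in> {0<..<u}"
        hence "v \<in> {0..T}" using that by auto
        from st[OF this] show "qd (clamp_ab (fst (x v))) < snd (x v)" using am by (simp add: clamp_id)
      qed
      thus ?thesis using x0 by simp
    qed
    have "energy (x t) \<le> energy (x 0)"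
    proof (rule energy_nonincreasing[OF x])
      fix u assume "u \<in> {0<..<t}"
      thus "fst (x u) \<in> {a<..<b}" using lt[of u] st(1)[of u] that(2) am by auto
    qed (use st[of 0] st[of t] that(2) am in auto)
    thus ?thesis using st[OF that(2)] lt that(2) by auto
  qed
  have "\<exists>t\<ge>0. fst (x t) \<le> s0"
  proof (rule ccontr)
    assume "\<not> ?thesis"
    hence gt: "s0 < fst (x t)" if "t \<ge> 0" for t using that by force
    hence D: "fst (x t) \<in> {m<..b}" "qd (fst (x t)) < snd (x t)" "energy (x t) \<le> energy (x 0)"
        "0 < t \<longrightarrow> fst (x t) < b" if "t \<ge> 0" for t
    proof -
      have "m < fst (x u)" if "u \<in> {0..t}" for u using gt[of u] that s0 by simp
      from drain[of t t, OF this] that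
      show "fst (x t) \<in> {m<..b}" "qd (fst (x t)) < snd (x t)" "energy (x t) \<le> energy (x 0)"
        "0 < t \<longrightarrow> fst (x t) < b" by simp_all
    qed
    obtain C where C: "\<And>z. fst z \<in> {a..b} \<Longrightarrow> \<bar>snd z\<bar> \<le> C + energy z"
      using pressure_bounded_by_energy by blast
    have p_le: "snd (x t) \<le> C + energy (x 0)" if "t \<ge> 0" for t
      using C[of "x t"] D(1,3)[OF that] am by auto
    have mono: "fst (x t) \<le> fst (x s)" "snd (x s) \<le> snd (x t)" if "0 \<le> s" "s \<le> t" for s t
      using drainage_monotone[OF x that(2)] D(1,2) that by (auto simp: less_imp_le)
    have "\<exists>l. ((\<lambda>t. fst (x (- t))) \<longlongrightarrow> l) at_bot"
      by (intro nondecreasing_bounded_below_converges_at_bot[of _ s0] mono(1) less_imp_le[OF gt]) auto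
    then obtain l1 where l1: "((\<lambda>t. fst (x t)) \<longlongrightarrow> l1) at_top"
      unfolding filterlim_at_top_mirror by blast
    have "\<exists>l. ((\<lambda>t. - snd (x (- t))) \<longlongrightarrow> l) at_bot"
      by (intro nondecreasing_bounded_below_converges_at_bot[of _ "- (C + energy (x 0))"] le_imp_neg_le
          mono(2) p_le) auto
    then obtain l2 where "((\<lambda>t. - snd (x t)) \<longlongrightarrow> l2) at_top"
      unfolding filterlim_at_top_mirror[of "\<lambda>t. - snd (x t)"] by blast
    from tendsto_minus[OF this] have l2: "((\<lambda>t. snd (x t)) \<longlongrightarrow> - l2) at_top" by simp
    have lim: "(x \<longlongrightarrow> (l1, - l2)) at_top" using tendsto_Pair[OF l1 l2] by simp
    obtain L where "L > 0" "L-lipschitz_on UNIV velocity" using velocity_lipschitz by blast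
    hence "velocity (l1, - l2) = 0"
      using limit_of_solution_is_equilibrium[OF _ _ x lim] filterlim_shift_at_top by auto
    hence "g (clamp_ab l1) = 0" by (simp add: velocity_def zero_prod_def)
    moreover have "s0 \<le> l1"
      by (rule tendsto_lowerbound[OF l1]) (auto simp: eventually_at_top_linorder intro!: exI[of _ 0] less_imp_le[OF gt])
    moreover have "l1 \<le> fst (x 1)"
      by (rule tendsto_upperbound[OF l1]) (use mono(1)[of 1] in \<open>auto simp: eventually_at_top_linorder intro!: exI[of _ 1]\<close>)
    ultimately show False using D(4)[of 1] s0 am g_pos[of l1] by (simp add: clamp_id)
  qed
  then obtain t1 where t1: "t1 \<ge> 0" "fst (x t1) \<le> s0" by blast
  have "continuous_on {0..t1} (\<lambda>t. fst (x t))" by (intro continuous_intros solution_continuous x)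
  from first_time_at_level[OF this t1(1) _ t1(2)] x0 s0
  obtain T where T: "T \<in> {0<..t1}" "fst (x T) = s0" "\<And>u. u \<in> {0..<T} \<Longrightarrow> s0 < fst (x u)"
    by auto
  have ge: "s0 \<le> fst (x u)" if "u \<in> {0..T}" for u
    using T(2) T(3)[of u] that by (cases "u = T") auto
  hence "m < fst (x u)" if "u \<in> {0..T}" for u using s0 that by force
  from drain[of T, OF this] ge T show ?thesis
    by (intro exI[of _ T]) (auto simp: less_imp_le)
qed

lemma tendsto_qd_clamp:
  assumes "(f \<longlongrightarrow> l) A"
  shows "((\<lambda>n. qd (clamp_ab (f n))) \<longlongrightarrow> qd (clamp_ab l)) A"
proof -
  have "continuous_on UNIV (\<lambda>s. qd (clamp_ab s))"
    by (rule continuous_on_compose2[OF cont_q(2) continuous_clamp]) (use clamp_in in auto)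
  from continuous_on_tendsto_compose[OF this assms] show ?thesis by simp
qed

lemma velocity_corner: "velocity (b, qd b) = 0"
  using ab g_b by (subst velocity_drainage) (auto simp: zero_prod_def)

lemma corner_solves: "solves velocity (\<lambda>t. (b, qd b))"
  by (simp add: solves_def velocity_corner)

text \<open>The backward half of the unstable orbit of the corner \<open>(b, qd b)\<close>, found by compactness. The
  solutions \<open>x n\<close> start at distance \<open>1 / (n + 1)\<close> above the corner and pass \<open>s0\<close> at time \<open>T n\<close>.
  By Gronwall's estimate against the resting solution, \<open>T n\<close> tends to infinity. A limit
  point of the passage points therefore has a backward orbit that stays in the drainage region for
  all negative times.\<close>

lemma exists_backward_drainage_orbit:
  assumes s0: "s0 \<in> {m<..<b}"
  shows "\<exists>x. solves velocity x \<and> fst (x 0) = s0 \<and>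
    (\<forall>t\<le>0. fst (x t) \<in> {s0..b} \<and> qd (fst (x t)) \<le> snd (x t))"
proof -
  define q where "q n = (b, qd b + inverse (real (Suc n)))" for n
  have "\<exists>x T. solves velocity x \<and> x 0 = q n \<and> T \<ge> 0 \<and> fst (x T) = s0 \<and> energy (x T) \<le> energy (q n) \<and>
      (\<forall>t\<in>{0..T}. fst (x t) \<in> {s0..b} \<and> qd (fst (x t)) \<le> snd (x t))" for n
  proof -
    obtain x where x: "solves velocity x" "x 0 = q n" using exists_solution by blast
    have "fst (x 0) = b" "qd b < snd (x 0)" using x(2) by (simp_all add: q_def)
    from reaches_saturation[OF x(1) this s0] x show ?thesis by metis
  qed
  then obtain x T where x: "\<And>n. solves velocity (x n)" and x0: "\<And>n. x n 0 = q n"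
    and T: "\<And>n. T n \<ge> (0::real)" "\<And>n. fst (x n (T n)) = s0" "\<And>n. energy (x n (T n)) \<le> energy (q n)"
    and xT: "\<And>n t. t \<in> {0..T n} \<Longrightarrow> fst (x n t) \<in> {s0..b} \<and> qd (fst (x n t)) \<le> snd (x n t)"
    by metis
  obtain L where L: "L > 0" "L-lipschitz_on UNIV velocity" using velocity_lipschitz by blast
  have T_large: "\<forall>\<^sub>F n in sequentially. t \<le> T n" for t
  proof -
    have "(\<lambda>n. exp (L * t) * inverse (real (Suc n))) \<longlonglongrightarrow> exp (L * t) * 0"
      by (intro tendsto_intros LIMSEQ_inverse_real_of_nat)
    hence "\<forall>\<^sub>F n in sequentially. exp (L * t) * inverse (real (Suc n)) < b - s0"
      by (rule order_tendstoD(2)) (use s0 in simp)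
    thus ?thesis
    proof eventually_elim
      case (elim n)
      show ?case
      proof (rule ccontr)
        assume "\<not> t \<le> T n"
        have "b - s0 \<le> norm (fst (x n (T n) - (b, qd b)))" using T(2)[of n] s0 by simp
        also have "\<dots> \<le> norm (x n (T n) - (b, qd b))" by (metis norm_fst_le prod.collapse)
        also have "\<dots> \<le> exp (L * \<bar>T n - 0\<bar>) * norm (x n 0 - (b, qd b))"
          by (rule norm_diff_solutions_le[OF L(2) x corner_solves])
        also have "\<dots> = exp (L * T n) * inverse (real (Suc n))"
          using T(1)[of n] by (simp add: x0 q_def norm_Pair)
        also have "\<dots> \<le> exp (L * t) * inverse (real (Suc n))"
          using \<open>\<not> t \<le> T n\<close> L by (intro mult_right_mono) auto
        finally show False using elim by simp
      qed
    qed
  qed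
  obtain C where C: "\<And>z. fst z \<in> {a..b} \<Longrightarrow> \<bar>snd z\<bar> \<le> C + energy z"
    using pressure_bounded_by_energy by blast
  have eq: "energy (q n) \<le> k * \<Phi> b + 1" for n
  proof -
    have "imb b (qd b + inverse (real (Suc n))) = 0"
      using qi_le_qd[of b] ab by (simp add: imb_def max_def) (smt (verit) of_nat_0_le_iff inverse_nonnegative_iff_nonnegative)
    moreover have "dra b (qd b + inverse (real (Suc n))) = inverse (real (Suc n))"
      by (simp add: dra_def)
    moreover have "(inverse (real (Suc n)))\<^sup>2 \<le> 1" by (simp add: inverse_le_1_iff power_le_one)
    ultimately show ?thesis by (simp add: energy_def q_def)
  qed
  have p_bd: "norm (snd (x n (T n))) \<le> C + (k * \<Phi> b + 1)" for n
    using C[of "x n (T n)"] T(2,3)[of n] eq[of n] s0 am by auto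
  hence "bounded (range (\<lambda>n. snd (x n (T n))))" unfolding bounded_iff by blast
  then obtain p r where r: "strict_mono r" and p: "((\<lambda>n. snd (x n (T n))) \<circ> r) \<longlonglongrightarrow> p"
    using bounded_imp_convergent_subsequence by blast
  obtain y where y: "solves velocity y" "y 0 = (s0, p)" using exists_solution by blast
  have "(\<lambda>n. (s0, snd (x (r n) (T (r n))))) \<longlonglongrightarrow> (s0, p)"
    using p by (intro tendsto_Pair tendsto_const) (simp add: o_def)
  have "(\<lambda>n. x (r n) (T (r n))) \<longlonglongrightarrow> y 0"
  proof -
    have "x (r n) (T (r n)) = (s0, snd (x (r n) (T (r n))))" for n
      using T(2)[of "r n"] by (simp add: prod_eq_iff)
    thus ?thesis using \<open>(\<lambda>n. (s0, snd (x (r n) (T (r n))))) \<longlonglongrightarrow> (s0, p)\<close> y(2)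
      by presburger
  qed
  hence lim: "(\<lambda>n. x (r n) (T (r n) + t)) \<longlonglongrightarrow> y t" for t
    using solutions_tendsto[OF L(2), of "\<lambda>n. x (r n)" y "\<lambda>n. T (r n)"] x y by simp
  have "fst (y t) \<in> {s0..b} \<and> qd (fst (y t)) \<le> snd (y t)" if t: "t \<le> 0" for t
  proof -
    have ev: "\<forall>\<^sub>F n in sequentially. fst (x (r n) (T (r n) + t)) \<in> {s0..b} \<and>
        qd (fst (x (r n) (T (r n) + t))) \<le> snd (x (r n) (T (r n) + t))"
      using eventually_subseq[OF r T_large[of "- t"]]
      by eventually_elim (use xT t in force)
    have ev2: "\<forall>\<^sub>F n in sequentially. qd (clamp_ab (fst (x (r n) (T (r n) + t)))) \<le> snd (x (r n) (T (r n) + t))"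
      using ev by eventually_elim (use s0 am in \<open>auto simp: clamp_id\<close>)
    have 1: "s0 \<le> fst (y t)"
      by (rule tendsto_lowerbound[OF tendsto_fst[OF lim]]) (use ev in \<open>auto elim: eventually_mono\<close>)
    moreover have 2: "fst (y t) \<le> b"
      by (rule tendsto_upperbound[OF tendsto_fst[OF lim]]) (use ev in \<open>auto elim: eventually_mono\<close>)
    moreover have "qd (clamp_ab (fst (y t))) \<le> snd (y t)"
      by (rule tendsto_le[OF _ tendsto_snd[OF lim] tendsto_qd_clamp[OF tendsto_fst[OF lim]] ev2]) simp
    ultimately show ?thesis using s0 am by (simp add: clamp_id)
  qed
  thus ?thesis using y by (intro exI[of _ y]) auto
qed

text \<open>Backward in time the orbit is monotone in both components, hence convergent to an equilibrium, and
  the corner is the only one with saturation in \<open>[s0, b]\<close> and pressure on or above the drainage curve. The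
  orbit stays strictly above that curve, so energy is really dissipated. The resulting
  strict inequality is what keeps the orbit away from \<open>b\<close> later.\<close>

lemma backward_drainage_orbit_emanates_from_corner:
  assumes s0: "s0 \<in> {m<..<b}" and x: "solves velocity x" and x0: "fst (x 0) = s0"
    and drain: "\<And>t. t \<le> 0 \<Longrightarrow> fst (x t) \<in> {s0..b} \<and> qd (fst (x t)) \<le> snd (x t)"
  shows "(x \<longlongrightarrow> (b, qd b)) at_bot" and "\<And>t. t \<le> 0 \<Longrightarrow> fst (x t) \<in> {a<..<b}"
    and "energy (x 0) < k * \<Phi> b"
proof -
  obtain L where L: "L > 0" "L-lipschitz_on UNIV velocity" using velocity_lipschitz by blast
  have mono: "fst (x t) \<le> fst (x s)" "snd (x s) \<le> snd (x t)" if "s \<le> t" "t \<le> 0" for s t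
  proof -
    have "fst (x u) \<in> {m<..b}" "qd (fst (x u)) \<le> snd (x u)" if "u \<in> {s..t}" for u
      using drain[of u] that \<open>t \<le> 0\<close> s0 by auto
    from drainage_monotone[OF x that(1) this]
    show "fst (x t) \<le> fst (x s)" "snd (x s) \<le> snd (x t)" by simp_all
  qed
  have lt: "fst (x t) < b" if t: "t \<le> 0" for t
  proof (rule ccontr)
    assume "\<not> fst (x t) < b"
    hence const: "fst (x u) = b" if "u \<le> t" for u
      using mono(1)[OF that t] drain[of u] that t by auto
    \<comment> \<open>The saturation would be constant up to time \<open>t\<close>, hence the orbit at rest in the corner.\<close>
    have "((\<lambda>u. b) has_real_derivative fst (velocity (x (t - 1)))) (at (t - 1))"
      by (rule has_field_derivative_transform_within_open[OF solution_components(1)[OF x], where S = "{..<t}"])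
         (auto simp: const)
    hence "fst (velocity (x (t - 1))) = 0" using DERIV_unique DERIV_const by blast
    hence "x (t - 1) = (b, qd b)"
      using velocity_drainage[of "x (t - 1)"] drain[of "t - 1"] const[of "t - 1"] t k s0 am
      by (auto simp: prod_eq_iff)
    hence "norm (x 0 - (b, qd b)) \<le> 0"
      using norm_diff_solutions_le[OF L(2) x corner_solves, of 0 "t - 1"] by simp
    hence "fst (x 0) = b" by simp
    thus False using x0 s0 by simp
  qed
  show inside: "fst (x t) \<in> {a<..<b}" if "t \<le> 0" for t
    using lt[OF that] drain[OF that] s0 am by auto
  have above: "qd (fst (x t)) < snd (x t)" if t: "t \<le> 0" for t
  proof (rule ccontr)
    assume "\<not> ?thesis"
    hence "snd (x t) = qd (fst (x t))" using drain[OF t] by simp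
    moreover have "fst (x t) \<in> {m<..<b}" using lt[OF t] drain[OF t] s0 by auto
    ultimately obtain d where d: "d > 0" "\<forall>h>0. h < d \<longrightarrow> snd (x (t - h)) < qd (fst (x (t - h)))"
      using pressure_rises_through_drainage_curve[OF x] by blast
    hence "snd (x (t - d / 2)) < qd (fst (x (t - d / 2)))" by simp
    thus False using drain[of "t - d / 2"] t d(1) by simp
  qed
  obtain c where c: "\<And>s. s \<in> {a..b} \<Longrightarrow> c \<le> qd s"
    using continuous_attains_inf[OF compact_Icc _ cont_q(2)] ab by (metis atLeastatMost_empty_iff2 less_imp_le not_less)
  have in_ab: "fst (x t) \<in> {a..b}" if "t \<le> 0" for t using inside[OF that] by simp
  have "\<exists>l. ((\<lambda>t. - fst (x t)) \<longlongrightarrow> l) at_bot"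
    by (intro nondecreasing_bounded_below_converges_at_bot[of _ "- b"] le_imp_neg_le mono(1)
        less_imp_le[OF lt]) auto
  then obtain l1 where "((\<lambda>t. - fst (x t)) \<longlongrightarrow> l1) at_bot" by blast
  from tendsto_minus[OF this] have l1: "((\<lambda>t. fst (x t)) \<longlongrightarrow> - l1) at_bot" by simp
  have "c \<le> snd (x t)" if "t \<le> 0" for t
    using c[OF in_ab[OF that]] drain[OF that] by simp
  hence "\<exists>l. ((\<lambda>t. snd (x t)) \<longlongrightarrow> l) at_bot"
    by (intro nondecreasing_bounded_below_converges_at_bot[of _ c] mono(2)) auto
  then obtain l2 where l2: "((\<lambda>t. snd (x t)) \<longlongrightarrow> l2) at_bot" by blast
  have lim: "(x \<longlongrightarrow> (- l1, l2)) at_bot" using tendsto_Pair[OF l1 l2] by simp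
  have f0: "velocity (- l1, l2) = 0"
    using limit_of_solution_is_equilibrium[OF L(2,1) x lim] filterlim_shift_at_bot by simp
  have ev: "\<forall>\<^sub>F t in at_bot. s0 \<le> fst (x t) \<and> fst (x t) \<le> b \<and> fst (x t) \<in> {a..b} \<and>
      qd (clamp_ab (fst (x t))) \<le> snd (x t)"
    unfolding eventually_at_bot_linorder
  proof (intro exI[of _ 0] allI impI)
    fix t :: real assume "t \<le> 0"
    from drain[OF this] in_ab[OF this]
    show "s0 \<le> fst (x t) \<and> fst (x t) \<le> b \<and> fst (x t) \<in> {a..b} \<and>
        qd (clamp_ab (fst (x t))) \<le> snd (x t)" by (simp add: clamp_id)
  qed
  have "s0 \<le> - l1"
    by (rule tendsto_lowerbound[OF l1]) (use ev in \<open>auto elim: eventually_mono\<close>)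
  moreover have "- l1 \<le> b"
    by (rule tendsto_upperbound[OF l1]) (use ev in \<open>auto elim: eventually_mono\<close>)
  ultimately have l1_in: "- l1 \<in> {s0..b}" "- l1 \<in> {a..b}" using s0 am by auto
  have "qd (clamp_ab (- l1)) \<le> l2"
    by (rule tendsto_le[OF _ l2 tendsto_qd_clamp[OF l1]])
       (use ev in \<open>auto elim: eventually_mono\<close>)
  hence "qd (- l1) \<le> l2" using l1_in by (simp add: clamp_id)
  hence fl: "(qd (- l1) - l2) / k = 0" "g (- l1) = 0"
    using f0 velocity_drainage[of "(- l1, l2)"] l1_in by (auto simp: zero_prod_def)
  have "- l1 = b" using fl(2) g_pos[of "- l1"] l1_in s0 by (cases "- l1 = b") auto
  moreover from this fl(1) k have "l2 = qd b" by simp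
  ultimately show corner: "(x \<longlongrightarrow> (b, qd b)) at_bot" using lim by simp
  have "energy (x 0) < energy (x (- 1))"
  proof (rule DERIV_neg_imp_decreasing_open[of "- 1" 0])
    fix u :: real assume u: "- 1 < u" "u < 0"
    hence "dra (fst (x u)) (snd (x u)) \<noteq> 0" using above[of u] by (simp add: dra_def)
    with energy_derivative[OF x inside[of u]] u
    show "\<exists>y. ((\<lambda>t. energy (x t)) has_real_derivative y) (at u) \<and> y < 0"
      by (metis less_eq_real_def less_imp_le)
  next
    show "continuous_on {- 1..0} (\<lambda>t. energy (x t))"
      by (rule energy_along_continuous[OF x]) (use in_ab in auto)
  qed simp
  also have "energy (x (- 1)) \<le> energy (b, qd b)"
  proof (rule tendsto_lowerbound)
    show "((\<lambda>t. energy (x t)) \<longlongrightarrow> energy (b, qd b)) at_bot"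
      by (rule continuous_on_tendsto_compose[OF continuous_energy corner])
         (use ab ev in \<open>auto simp: mem_Times_iff elim!: eventually_mono\<close>)
    show "\<forall>\<^sub>F t in at_bot. energy (x (- 1)) \<le> energy (x t)"
      unfolding eventually_at_bot_linorder
    proof (intro exI[of _ "- 1"] allI impI)
      fix t :: real assume "t \<le> - 1"
      thus "energy (x (- 1)) \<le> energy (x t)"
        using inside in_ab by (intro energy_nonincreasing[OF x]) auto
    qed
  qed simp
  also have "energy (b, qd b) = k * \<Phi> b"
    using qi_le_qd[of b] ab by (simp add: energy_def imb_def dra_def)
  finally show "energy (x 0) < k * \<Phi> b" .
qed

subsection \<open>Confinement and convergence\<close>

text \<open>At a first exit the potential alone would be at least \<open>k * \<Phi> b\<close>, on either rim of the well.\<close>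

lemma trapped_in_potential_well:
  assumes x: "solves velocity x" and E: "energy (x 0) < k * \<Phi> b" and x0: "fst (x 0) \<in> {a<..<b}" and "0 \<le> t"
  shows "fst (x t) \<in> {a<..<b}"
proof (rule ccontr)
  assume out: "fst (x t) \<notin> {a<..<b}"
  define f where "f t = min (fst (x t) - a) (b - fst (x t))" for t
  have "continuous_on {0..t} f"
    unfolding f_def by (intro continuous_intros solution_continuous x)
  moreover have "0 < f 0" using x0 by (simp add: f_def)
  moreover have "f t \<le> 0" using out by (auto simp: f_def min_def)
  ultimately obtain v where v: "v \<in> {0<..t}" "f v = 0" "\<And>u. u \<in> {0..<v} \<Longrightarrow> 0 < f u"
    using first_time_at_level[of t f 0] \<open>0 \<le> t\<close> by blast
  have v_end: "fst (x v) = a \<or> fst (x v) = b" using v(2) by (auto simp: f_def min_def split: if_splits)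
  have "energy (x v) \<le> energy (x 0)"
  proof (rule energy_nonincreasing[OF x])
    fix u assume "u \<in> {0<..<v}"
    thus "fst (x u) \<in> {a<..<b}" using v(3)[of u] by (simp add: f_def)
  qed (use v(1) v_end x0 ab in auto)
  moreover have "k * \<Phi> (fst (x v)) \<le> energy (x v)" by (simp add: energy_def)
  moreover have "k * \<Phi> b \<le> k * \<Phi> (fst (x v))" using v_end \<Phi>_ends k by auto
  ultimately show False using E by simp
qed

lemma equilibrium_in_segment:
  assumes "qi m \<le> p" "p \<le> qd m"
  shows "(m, p) \<in> closed_segment (m, qi m) (m, qd m)"
proof (cases "qi m = qd m")
  case False
  define u where "u = (p - qi m) / (qd m - qi m)"
  have "0 \<le> u" "u \<le> 1" using assms False by (auto simp: u_def)
  moreover have "p = (1 - u) * qi m + u * qd m"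
  proof -
    have "u * (qd m - qi m) = p - qi m" using False by (simp add: u_def)
    thus ?thesis by (simp add: algebra_simps)
  qed
  ultimately show ?thesis by (auto simp: in_segment algebra_simps)
qed (use assms in auto)

text \<open>LaSalle's invariance principle. Let \<open>z\<close> be a limit point of the orbit at positive distance from the segment. Along
  the solution \<open>y\<close> through \<open>z\<close> the energy is constant, so \<open>imb\<close> and \<open>dra\<close> vanish there. Then the
  saturation is at rest and the pressure is affine in time with slope \<open>g s\<close> but confined to
  \<open>[qi s, qd s]\<close>, so \<open>g s = 0\<close>, \<open>s = m\<close>, and \<open>z\<close> lies on the segment.\<close>

lemma converges_to_equilibrium_segment:
  assumes x: "solves velocity x" and E: "energy (x 0) < k * \<Phi> b"
    and inside: "\<And>t. t \<ge> 0 \<Longrightarrow> fst (x t) \<in> {a<..<b}"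
  shows "((\<lambda>t. infdist (x t) (closed_segment (m, qi m) (m, qd m))) \<longlongrightarrow> 0) at_top"
proof (rule ccontr)
  let ?seg = "closed_segment (m, qi m) (m, qd m)"
  assume "\<not> ?thesis"
  then obtain \<epsilon> where \<epsilon>: "\<epsilon> > 0" "\<not> (\<forall>\<^sub>F t in at_top. infdist (x t) ?seg < \<epsilon>)"
    unfolding tendsto_iff by (auto simp: dist_real_def infdist_nonneg)
  hence "\<exists>t\<ge>real n. infdist (x t) ?seg \<ge> \<epsilon>" for n
    unfolding eventually_at_top_linorder by (metis not_le)
  then obtain T where T: "\<And>n. real n \<le> T n" "\<And>n. \<epsilon> \<le> infdist (x (T n)) ?seg" by metis
  obtain L where L: "L > 0" "L-lipschitz_on UNIV velocity" using velocity_lipschitz by blast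
  have mono: "energy (x t) \<le> energy (x s)" if "0 \<le> s" "s \<le> t" for s t
    using inside that by (intro energy_nonincreasing[OF x that(2)]) (auto simp: less_imp_le)
  obtain C where C: "\<And>z. fst z \<in> {a..b} \<Longrightarrow> \<bar>snd z\<bar> \<le> C + energy z"
    using pressure_bounded_by_energy by blast
  have in_ab: "fst (x t) \<in> {a..b}" if "t \<ge> 0" for t using inside[OF that] by simp
  have "\<exists>l. ((\<lambda>t. energy (x (- t))) \<longlongrightarrow> l) at_bot"
  proof (rule nondecreasing_bounded_below_converges_at_bot)
    fix t :: real assume "t \<le> 0"
    thus "- C \<le> energy (x (- t))" using C[OF in_ab[of "- t"]] abs_ge_zero[of "snd (x (- t))"] by linarith
  qed (use mono in auto)
  then obtain E_inf where E_inf: "((\<lambda>t. energy (x t)) \<longlongrightarrow> E_inf) at_top"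
    unfolding filterlim_at_top_mirror[of "\<lambda>t. energy (x t)"] by blast
  have "E_inf \<le> energy (x 0)"
    by (rule tendsto_upperbound[OF E_inf])
       (use mono[of 0] in \<open>auto simp: eventually_at_top_linorder intro!: exI[of _ 0]\<close>)
  hence Elim_lt: "E_inf < k * \<Phi> b" using E by simp
  have "x (T n) \<in> {a..b} \<times> {- (C + energy (x 0))..C + energy (x 0)}" for n
  proof -
    have "T n \<ge> 0" using T(1)[of n] of_nat_0_le_iff order_trans by blast
    thus ?thesis using C[OF in_ab[of "T n"]] in_ab[of "T n"] mono[of 0 "T n"]
      by (auto simp: mem_Times_iff)
  qed
  moreover have "compact ({a..b} \<times> {- (C + energy (x 0))..C + energy (x 0)})"
    by (intro compact_Times compact_Icc)
  ultimately obtain z r where r: "strict_mono r" and z: "((\<lambda>n. x (T n)) \<circ> r) \<longlonglongrightarrow> z"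
    using compact_imp_seq_compact seq_compactE[of _ "\<lambda>n. x (T n)"] by metis
  obtain y where y: "solves velocity y" "y 0 = z" using exists_solution by blast
  have lim: "(\<lambda>n. x (T (r n) + t)) \<longlonglongrightarrow> y t" for t
    using solutions_tendsto[OF L(2) x y(1), of "\<lambda>n. T (r n)"] z y(2) by (simp add: o_def)
  have T_top: "filterlim (\<lambda>n. T (r n) + t) at_top sequentially" for t
  proof (rule filterlim_compose[OF filterlim_shift_at_top])
    have "filterlim T at_top sequentially"
      by (rule filterlim_at_top_mono[OF filterlim_real_sequentially]) (use T(1) in auto)
    thus "filterlim (\<lambda>n. T (r n)) at_top sequentially"
      using filterlim_compose filterlim_subseq[OF r] by blast
  qed
  have ev: "\<forall>\<^sub>F n in sequentially. fst (x (T (r n) + t)) \<in> {a..b}" for t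
  proof -
    have "\<forall>\<^sub>F n in sequentially. 0 \<le> T (r n) + t" using T_top[of t] unfolding filterlim_at_top by blast
    thus ?thesis by eventually_elim (rule in_ab)
  qed
  have y_ab: "fst (y t) \<in> {a..b}" for t
    using Lim_in_closed_set[OF closed_atLeastAtMost ev[of t] _ tendsto_fst[OF lim[of t]]] by simp
  have y_E: "energy (y t) = E_inf" for t
  proof (rule LIMSEQ_unique)
    show "(\<lambda>n. energy (x (T (r n) + t))) \<longlonglongrightarrow> energy (y t)"
      by (rule continuous_on_tendsto_compose[OF continuous_energy lim])
         (use y_ab ev in \<open>auto simp: mem_Times_iff\<close>)
    show "(\<lambda>n. energy (x (T (r n) + t))) \<longlonglongrightarrow> E_inf"
      by (rule filterlim_compose[OF E_inf T_top])
  qed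
  have y_in: "fst (y t) \<in> {a<..<b}" for t
  proof -
    have "k * \<Phi> (fst (y t)) < k * \<Phi> b"
      using y_E[of t] Elim_lt zero_le_power2[of "imb (fst (y t)) (snd (y t))"]
        zero_le_power2[of "dra (fst (y t)) (snd (y t))"] unfolding energy_def by argo
    hence "\<Phi> (fst (y t)) < \<Phi> b" using k by simp
    hence "fst (y t) \<noteq> a" "fst (y t) \<noteq> b" using \<Phi>_ends by auto
    thus ?thesis using y_ab[of t] by auto
  qed
  have zero: "imb (fst (y t)) (snd (y t)) = 0 \<and> dra (fst (y t)) (snd (y t)) = 0" for t
  proof -
    have "((\<lambda>t. energy (y t)) has_real_derivative 0) (at t)" by (simp add: y_E)
    thus ?thesis using energy_derivative[OF y(1) y_in[of t]] DERIV_unique by blast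
  qed
  have f: "velocity (y t) = (0, g (fst (y t)))" for t
    using zero[of t] y_ab[of t] by (simp add: velocity_def clamp_id)
  have const: "fst (y t) = fst (y 0)" for t
    using DERIV_isconst_all[of "\<lambda>t. fst (y t)" t 0] solution_components(1)[OF y(1)] f by simp
  define s where "s = fst (y 0)"
  have p': "((\<lambda>t. snd (y t) - g s * t) has_real_derivative 0) (at t)" for t
    using solution_components(2)[OF y(1), of t] f[of t] const[of t]
    by (auto simp: s_def intro!: derivative_eq_intros)
  have p: "snd (y t) = snd (y 0) + g s * t" for t
    using DERIV_isconst_all[of "\<lambda>t. snd (y t) - g s * t" t 0] p' by simp
  have between: "qi s \<le> snd (y t)" "snd (y t) \<le> qd s" for t
    using zero[of t] const[of t] by (auto simp: imb_def dra_def s_def max_def split: if_splits)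
  have "g s = 0"
  proof (rule ccontr)
    assume "g s \<noteq> 0"
    hence "snd (y ((qd s - qi s + 1) / g s)) = snd (y 0) + (qd s - qi s + 1)"
      by (simp add: p[of "(qd s - qi s + 1) / g s"])
    thus False using between[of 0] between[of "(qd s - qi s + 1) / g s"] by linarith
  qed
  hence "s = m" using g_neg[of s] g_pos[of s] y_in[of 0] unfolding s_def
    by (metis greaterThanLessThan_iff less_irrefl linorder_neqE_linordered_idom)
  hence "z = (m, snd (y 0))" using y(2) by (auto simp: s_def prod_eq_iff)
  hence "z \<in> ?seg" using between[of 0] \<open>s = m\<close> equilibrium_in_segment by metis
  hence "infdist z ?seg = 0" by simp
  moreover have "(\<lambda>n. infdist (x (T (r n))) ?seg) \<longlonglongrightarrow> infdist z ?seg"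
    using z by (intro tendsto_infdist) (simp add: o_def)
  ultimately have "\<epsilon> \<le> 0" using T(2) by (intro LIMSEQ_le_const) auto
  thus False using \<epsilon> by simp
qed

theorem heteroclinic_orbit:
  "\<exists>x. solves velocity x \<and> (\<forall>t. fst (x t) \<in> {a<..<b}) \<and> (x \<longlongrightarrow> (b, qd b)) at_bot \<and>
     ((\<lambda>t. infdist (x t) (closed_segment (m, qi m) (m, qd m))) \<longlongrightarrow> 0) at_top"
proof -
  define s0 where "s0 = (m + b) / 2"
  have s0: "s0 \<in> {m<..<b}" using mb by (simp add: s0_def)
  obtain x where x: "solves velocity x" "fst (x 0) = s0"
    "\<And>t. t \<le> 0 \<Longrightarrow> fst (x t) \<in> {s0..b} \<and> qd (fst (x t)) \<le> snd (x t)"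
    using exists_backward_drainage_orbit[OF s0] by blast
  note origin = backward_drainage_orbit_emanates_from_corner[OF s0 x]
  have fwd: "fst (x t) \<in> {a<..<b}" if "t \<ge> 0" for t
    using trapped_in_potential_well[OF x(1) origin(3) origin(2)[of 0] that] by simp
  have "fst (x t) \<in> {a<..<b}" for t using origin(2)[of t] fwd[of t] by linarith
  thus ?thesis using x(1) origin(1) converges_to_equilibrium_segment[OF x(1) origin(3) fwd] by blast
qed

end

section \<open>Continuously differentiable functions\<close>

lemma C1_iff:
  "C_k_on 1 f X \<longleftrightarrow> (\<exists>f'. (\<forall>x\<in>X. (f has_real_derivative f' x) (at x within X)) \<and> continuous_on X f')"
  by simp

lemma C1_imp_continuous: "C_k_on 1 f X \<Longrightarrow> continuous_on X f"
  by (auto simp: C1_iff intro: DERIV_continuous_on)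

lemma C2_imp_C1: "C_k_on 2 f X \<Longrightarrow> C_k_on 1 f X"
  by (auto simp: numeral_2_eq_2 intro: DERIV_continuous_on)

lemma C1_subset:
  assumes "C_k_on 1 f X" "Y \<subseteq> X"
  shows "C_k_on 1 f Y"
  using assms unfolding C1_iff by (meson DERIV_subset continuous_on_subset subsetD)

lemma C1_const: "C_k_on 1 (\<lambda>x. c) X"
  unfolding C1_iff by (intro exI[of _ "\<lambda>x. 0"]) auto

lemma C1_ident: "C_k_on 1 (\<lambda>x. x) X"
  unfolding C1_iff by (intro exI[of _ "\<lambda>x. 1"]) auto

lemma C1_add:
  assumes "C_k_on 1 f X" "C_k_on 1 g X"
  shows "C_k_on 1 (\<lambda>x. f x + g x) X"
proof -
  from assms obtain f' g' where "\<forall>x\<in>X. (f has_real_derivative f' x) (at x within X)" "continuous_on X f'"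
    "\<forall>x\<in>X. (g has_real_derivative g' x) (at x within X)" "continuous_on X g'" unfolding C1_iff by blast
  thus ?thesis unfolding C1_iff
    by (intro exI[of _ "\<lambda>x. f' x + g' x"]) (auto intro!: DERIV_add continuous_intros)
qed

lemma C1_mult:
  assumes "C_k_on 1 f X" "C_k_on 1 g X"
  shows "C_k_on 1 (\<lambda>x. f x * g x) X"
proof -
  from assms obtain f' g' where "\<forall>x\<in>X. (f has_real_derivative f' x) (at x within X)" "continuous_on X f'"
    "\<forall>x\<in>X. (g has_real_derivative g' x) (at x within X)" "continuous_on X g'" unfolding C1_iff by blast
  thus ?thesis unfolding C1_iff using assms[THEN C1_imp_continuous]
    by (intro exI[of _ "\<lambda>x. f' x * g x + g' x * f x"]) (auto intro!: DERIV_mult continuous_intros)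
qed

lemma C1_diff:
  assumes "C_k_on 1 f X" "C_k_on 1 g X"
  shows "C_k_on 1 (\<lambda>x. f x - g x) X"
  using C1_add[OF assms(1) C1_mult[OF C1_const[of "-1"] assms(2)]] by simp

lemma C1_divide:
  assumes "C_k_on 1 f X" "C_k_on 1 g X" and nz: "\<And>x. x \<in> X \<Longrightarrow> g x \<noteq> 0"
  shows "C_k_on 1 (\<lambda>x. f x / g x) X"
proof -
  from assms obtain f' g' where "\<forall>x\<in>X. (f has_real_derivative f' x) (at x within X)" "continuous_on X f'"
    "\<forall>x\<in>X. (g has_real_derivative g' x) (at x within X)" "continuous_on X g'" unfolding C1_iff by blast
  thus ?thesis unfolding C1_iff using assms(1,2)[THEN C1_imp_continuous] nz
    by (intro exI[of _ "\<lambda>x. (f' x * g x - f x * g' x) / (g x * g x)"])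
       (auto intro!: DERIV_divide continuous_intros)
qed

lemma C1_imp_lipschitz:
  assumes "C_k_on 1 f {a..b}"
  shows "\<exists>L. L-lipschitz_on {a..b} f"
proof -
  from assms obtain f' where f': "\<And>x. x \<in> {a..b} \<Longrightarrow> (f has_real_derivative f' x) (at x within {a..b})"
    and c: "continuous_on {a..b} f'" unfolding C1_iff by blast
  obtain B where B: "\<And>x. x \<in> {a..b} \<Longrightarrow> \<bar>f' x\<bar> \<le> B"
    using compact_imp_bounded[OF compact_continuous_image[OF c compact_Icc]] unfolding bounded_iff
    by (metis image_eqI real_norm_def)
  have "\<bar>B\<bar>-lipschitz_on {a..b} f"
  proof (rule lipschitz_onI)
    fix x y assume xy: "x \<in> {a..b}" "y \<in> {a..b}"
    have "norm (f x - f y) \<le> \<bar>B\<bar> * norm (x - y)"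
      by (rule field_differentiable_bound[OF _ f' _ xy]) (use B in force)+
    thus "dist (f x) (f y) \<le> \<bar>B\<bar> * dist x y" by (simp add: dist_norm)
  qed simp
  thus ?thesis by blast
qed

lemma continuous_has_primitive_on:
  fixes g :: "real \<Rightarrow> real"
  assumes "continuous_on {a..b} g"
  obtains \<Phi> where "continuous_on {a..b} \<Phi>"
    "\<And>s. s \<in> {a<..<b} \<Longrightarrow> (\<Phi> has_real_derivative g s) (at s)"
proof
  have d: "((\<lambda>u. integral {a..u} g) has_real_derivative g s) (at s within {a..b})" if "s \<in> {a..b}" for s
    using assms that by (rule integral_has_real_derivative)
  show "continuous_on {a..b} (\<lambda>u. integral {a..u} g)" using d by (rule DERIV_continuous_on)
  fix s assume "s \<in> {a<..<b}"
  with d[of s] show "((\<lambda>u. integral {a..u} g) has_real_derivative g s) (at s)"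
    using at_within_interior[of s "{a..b}"] by simp
qed

section \<open>Convex-concave functions and chords\<close>

text \<open>Strict convexity on \<open>[l, r]\<close> in the form \<open>slope(x, y) < slope(y, z)\<close>, cleared of denominators: this
  form is not affected by subtracting a line.\<close>

definition increasing_slopes :: "real \<Rightarrow> real \<Rightarrow> (real \<Rightarrow> real) \<Rightarrow> bool" where
  "increasing_slopes l r f \<longleftrightarrow>
     (\<forall>x y z. l \<le> x \<and> x < y \<and> y < z \<and> z \<le> r \<longrightarrow> (f y - f x) * (z - y) < (f z - f y) * (y - x))"

lemma increasing_slopesI:
  assumes c: "continuous_on {l..r} f" and f': "\<And>x. x \<in> {l<..<r} \<Longrightarrow> (f has_real_derivative f' x) (at x)"
    and mono: "\<And>x y. l < x \<Longrightarrow> x < y \<Longrightarrow> y < r \<Longrightarrow> f' x < f' y"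
  shows "increasing_slopes l r f"
  unfolding increasing_slopes_def
proof (intro allI impI)
  fix x y z assume xyz: "l \<le> x \<and> x < y \<and> y < z \<and> z \<le> r"
  have mvt: "\<exists>u. p < u \<and> u < q \<and> f q - f p = (q - p) * f' u" if "l \<le> p" "p < q" "q \<le> r" for p q
  proof -
    have "\<exists>d u. p < u \<and> u < q \<and> (f has_real_derivative d) (at u) \<and> f q - f p = (q - p) * d"
    proof (rule MVT[OF \<open>p < q\<close>])
      show "continuous_on {p..q} f" using continuous_on_subset[OF c] that by auto
      fix u assume "p < u" "u < q"
      hence "u \<in> {l<..<r}" using that by auto
      from f'[OF this] show "f differentiable (at u)" using real_differentiable_def by blast
    qed
    then obtain d u where u: "p < u" "u < q" "(f has_real_derivative d) (at u)" "f q - f p = (q - p) * d"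
      by blast
    have "u \<in> {l<..<r}" using u that by auto
    with u f' have "d = f' u" using DERIV_unique by blast
    thus ?thesis using u by blast
  qed
  obtain u where u: "x < u" "u < y" "f y - f x = (y - x) * f' u" using mvt[of x y] xyz by auto
  obtain v where v: "y < v" "v < z" "f z - f y = (z - y) * f' v" using mvt[of y z] xyz by auto
  have "f' u < f' v" using u v xyz by (intro mono) auto
  hence "(y - x) * (z - y) * f' u < (y - x) * (z - y) * f' v" using xyz by simp
  moreover have "(f y - f x) * (z - y) = (y - x) * (z - y) * f' u"
    "(f z - f y) * (y - x) = (y - x) * (z - y) * f' v"
    unfolding u(3) v(3) by (simp_all only: mult_ac)
  ultimately show "(f y - f x) * (z - y) < (f z - f y) * (y - x)" by (simp only:)
qed

lemma increasing_slopes_minus_line: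
  "increasing_slopes l r f \<Longrightarrow> increasing_slopes l r (\<lambda>x. f x - (p + c * (x - q)))"
  unfolding increasing_slopes_def by (simp add: algebra_simps)

lemma decreasing_slopes_minus_line:
  assumes "increasing_slopes l r (\<lambda>x. - f x)"
  shows "increasing_slopes l r (\<lambda>x. - (f x - (p + c * (x - q))))"
  using increasing_slopes_minus_line[OF assms, of "- p" "- c" q] by (simp add: algebra_simps)

text \<open>A function that is strictly convex up to \<open>o'\<close> and strictly concave from there on, with zeros
  \<open>m < b\<close> and \<open>f a \<le> 0\<close> at a point \<open>a < m\<close> of the convex part, changes its sign exactly at \<open>m\<close>
  on \<open>(a, b)\<close>. It is applied to \<open>F\<close> minus the chord through \<open>SB\<close> (where \<open>f a = 0\<close>) and to \<open>F\<close> minus the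
  line through \<open>ST\<close> and \<open>SH\<close> (where \<open>f a < 0\<close>), in both cases with \<open>a = SB\<close> and \<open>b = SH\<close>.\<close>

lemma convex_concave_sign:
  assumes conv: "increasing_slopes l o' f" and conc: "increasing_slopes o' r (\<lambda>x. - f x)"
    and ord: "l \<le> a" "a < m" "m < b" "b \<le> r" "a < o'"
    and fa: "f a \<le> 0" and fm: "f m = 0" and fb: "f b = 0"
  shows "\<And>s. s \<in> {m<..<b} \<Longrightarrow> 0 < f s" and "\<And>s. s \<in> {a<..<m} \<Longrightarrow> f s < 0"
proof -
  have cv: "(f y - f x) * (z - y) < (f z - f y) * (y - x)" if "l \<le> x" "x < y" "y < z" "z \<le> o'" for x y z
    using conv that unfolding increasing_slopes_def by blast
  have cc: "(f z - f y) * (y - x) < (f y - f x) * (z - y)" if "o' \<le> x" "x < y" "y < z" "z \<le> r" for x y z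
    using conc that unfolding increasing_slopes_def by (smt (verit) mult_minus_left)
  have c1: "f y < 0" if "l \<le> x" "x < y" "y < z" "z \<le> o'" "f x \<le> 0" "f z \<le> 0" for x y z
  proof (rule ccontr)
    assume "\<not> f y < 0"
    hence "0 \<le> (f y - f x) * (z - y)" "(f z - f y) * (y - x) \<le> 0"
      using that by (auto intro!: mult_nonneg_nonneg mult_nonpos_nonneg)
    thus False using cv[of x y z] that by simp
  qed
  have c2: "0 < f z" if "l \<le> x" "x < y" "y < z" "z \<le> o'" "f x \<le> 0" "f y = 0" for x y z
  proof -
    have "0 \<le> - f x * (z - y)" using that by (intro mult_nonneg_nonneg) auto
    hence "0 < f z * (y - x)" using cv[of x y z] that by simp
    thus ?thesis using that by (simp add: zero_less_mult_iff)
  qed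
  have d1: "0 < f y" if "o' \<le> x" "x < y" "y < z" "z \<le> r" "f x \<ge> 0" "f z \<ge> 0" for x y z
  proof (rule ccontr)
    assume "\<not> 0 < f y"
    hence "(f y - f x) * (z - y) \<le> 0" "0 \<le> (f z - f y) * (y - x)"
      using that by (auto intro!: mult_nonneg_nonneg mult_nonpos_nonneg)
    thus False using cc[of x y z] that by simp
  qed
  have d2: "f x < 0" if "o' \<le> x" "x < y" "y < z" "z \<le> r" "f y = 0" "f z = 0" for x y z
  proof -
    have "0 < - f x * (z - y)" using cc[of x y z] that by simp
    thus ?thesis using that by (simp add: zero_less_mult_iff mult_less_0_iff)
  qed
  have "o' < b" using c1[of a m b] ord fa fm fb by force
  show "0 < f s" if s: "s \<in> {m<..<b}" for s
  proof (cases "o' \<le> m")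
    case True
    thus ?thesis using d1[of m s b] s ord fm fb by auto
  next
    case False
    show ?thesis
    proof (cases "s \<le> o'")
      case True
      thus ?thesis using c2[of a m s] s ord fa fm by auto
    next
      case s': False
      have "0 < f o'" using c2[of a m o'] False ord fa fm by auto
      thus ?thesis using d1[of o' s b] s s' ord fb by auto
    qed
  qed
  show "f s < 0" if s: "s \<in> {a<..<m}" for s
  proof (cases "o' < m")
    case True
    have o: "f o' < 0" using d2[of o' m b] True ord fm fb by auto
    show ?thesis
    proof (cases "o' \<le> s")
      case True
      thus ?thesis using d2[of s m b] s ord fm fb by auto
    next
      case False
      thus ?thesis using c1[of a s o'] s o ord fa by auto
    qed
  next
    case False
    thus ?thesis using c1[of a s m] s ord fa fm by auto
  qed
qed

lemma has_derivative_at_interior: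
  fixes f :: "real \<Rightarrow> real"
  assumes "(f has_real_derivative d) (at x within X)" "{l<..<r} \<subseteq> X" "x \<in> {l<..<r}"
  shows "(f has_real_derivative d) (at x)"
  using DERIV_subset[OF assms(1,2)] at_within_open[OF assms(3)] by simp

lemma C2_second_derivative:
  assumes "C_k_on 2 f {l..r}" and x: "x \<in> {l<..<r}"
  shows "(f has_real_derivative deriv f x) (at x)"
    and "(deriv f has_real_derivative deriv (deriv f) x) (at x)"
proof -
  obtain f' f'' where f': "\<And>y. y \<in> {l..r} \<Longrightarrow> (f has_real_derivative f' y) (at y within {l..r})"
    and f'': "\<And>y. y \<in> {l..r} \<Longrightarrow> (f' has_real_derivative f'' y) (at y within {l..r})"
    using assms(1) unfolding numeral_2_eq_2 C_k_on.simps by metis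
  have d: "(f has_real_derivative f' y) (at y)" if "y \<in> {l<..<r}" for y
    using f' that by (intro has_derivative_at_interior[of f _ _ "{l..r}" l r]) auto
  hence e: "deriv f y = f' y" if "y \<in> {l<..<r}" for y using that DERIV_imp_deriv by blast
  show "(f has_real_derivative deriv f x) (at x)" using d[OF x] e[OF x] by simp
  have "(f' has_real_derivative f'' x) (at x)"
    using f'' x by (intro has_derivative_at_interior[of f' _ _ "{l..r}" l r]) auto
  hence "(deriv f has_real_derivative f'' x) (at x)"
    by (rule has_field_derivative_transform_within_open[where S = "{l<..<r}"]) (use x e in auto)
  thus "(deriv f has_real_derivative deriv (deriv f) x) (at x)" using DERIV_imp_deriv by metis
qed

lemma convex_concave_flux_slopes:
  assumes "convex_concave_flux F So"
  shows "increasing_slopes 0 So F" and "increasing_slopes So 1 (\<lambda>x. - F x)"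
    and "\<And>x y. 0 \<le> x \<Longrightarrow> x < y \<Longrightarrow> y \<le> 1 \<Longrightarrow> F x < F y"
proof -
  have C2: "C_k_on 2 F {0..1}" and F': "\<And>S. S \<in> {0<..<1} \<Longrightarrow> deriv F S > 0"
    and So: "So \<in> {0<..<1}" and p: "\<And>S. S \<in> {0<..<So} \<Longrightarrow> deriv (deriv F) S > 0"
    and n: "\<And>S. S \<in> {So<..<1} \<Longrightarrow> deriv (deriv F) S < 0"
    using assms by (auto simp: convex_concave_flux_def)
  have c: "continuous_on {0..1} F" using C2 C2_imp_C1 C1_imp_continuous by blast
  note d = C2_second_derivative[OF C2]
  show "increasing_slopes 0 So F"
  proof (rule increasing_slopesI[where f' = "deriv F"])
    show "continuous_on {0..So} F" using continuous_on_subset[OF c] So by auto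
    show "deriv F x < deriv F y" if "0 < x" "x < y" "y < So" for x y
    proof (rule DERIV_pos_imp_increasing[OF \<open>x < y\<close>])
      fix z assume "x \<le> z" "z \<le> y"
      thus "\<exists>D. (deriv F has_real_derivative D) (at z) \<and> 0 < D" using d(2)[of z] p[of z] that So by auto
    qed
  qed (use d(1) So in auto)
  show "increasing_slopes So 1 (\<lambda>x. - F x)"
  proof (rule increasing_slopesI[where f' = "\<lambda>x. - deriv F x"])
    show "continuous_on {So..1} (\<lambda>x. - F x)"
      using continuous_on_subset[OF c] So by (intro continuous_intros) auto
    show "- deriv F x < - deriv F y" if "So < x" "x < y" "y < 1" for x y
    proof -
      have "deriv F y < deriv F x"
      proof (rule DERIV_neg_imp_decreasing[OF \<open>x < y\<close>])
        fix z assume "x \<le> z" "z \<le> y"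
        thus "\<exists>D. (deriv F has_real_derivative D) (at z) \<and> D < 0" using d(2)[of z] n[of z] that So by auto
      qed
      thus ?thesis by simp
    qed
  qed (use d(1) So in \<open>auto intro!: DERIV_minus\<close>)
  fix x y :: real assume xy: "0 \<le> x" "x < y" "y \<le> 1"
  show "F x < F y"
  proof (rule DERIV_pos_imp_increasing_open[OF \<open>x < y\<close>])
    show "continuous_on {x..y} F" using continuous_on_subset[OF c] xy by auto
    fix z assume "x < z" "z < y"
    thus "\<exists>D. (F has_real_derivative D) (at z) \<and> 0 < D" using d(1)[of z] F'[of z] xy by auto
  qed
qed

section \<open>The flux functions and capillary pressures\<close>

lemma rel_perm_wetting_pos:
  assumes "rel_perm_wetting krw" "0 < s" "s \<le> 1"
  shows "0 < krw s"
proof -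
  have C2: "C_k_on 2 krw {0..1}" and 0: "krw 0 = 0"
    and d: "\<And>S. S \<in> {0<..1} \<Longrightarrow> \<exists>d>0. (krw has_real_derivative d) (at S within {0..1})"
    using assms(1) by (auto simp: rel_perm_wetting_def)
  have c: "continuous_on {0..1} krw" using C2 C2_imp_C1 C1_imp_continuous by blast
  have "krw 0 < krw s"
  proof (rule DERIV_pos_imp_increasing_open[OF \<open>0 < s\<close>])
    show "continuous_on {0..s} krw" using continuous_on_subset[OF c] assms by auto
    fix z assume z: "0 < z" "z < s"
    then obtain d where "d > 0" "(krw has_real_derivative d) (at z within {0..1})"
      using d[of z] assms by auto
    moreover from this have "(krw has_real_derivative d) (at z)"
      using z assms by (intro has_derivative_at_interior[of krw _ _ "{0..1}" 0 1]) auto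
    ultimately show "\<exists>D. (krw has_real_derivative D) (at z) \<and> 0 < D" by blast
  qed
  thus ?thesis using 0 by simp
qed

lemma rel_perm_nonwetting_pos:
  assumes "rel_perm_nonwetting krn" "0 \<le> s" "s < 1"
  shows "0 < krn s"
proof -
  have C2: "C_k_on 2 krn {0..1}" and 0: "krn 1 = 0"
    and d: "\<And>S. S \<in> {0..<1} \<Longrightarrow> \<exists>d<0. (krn has_real_derivative d) (at S within {0..1})"
    using assms(1) by (auto simp: rel_perm_nonwetting_def)
  have c: "continuous_on {0..1} krn" using C2 C2_imp_C1 C1_imp_continuous by blast
  have "krn 1 < krn s"
  proof (rule DERIV_neg_imp_decreasing_open[OF \<open>s < 1\<close>])
    show "continuous_on {s..1} krn" using continuous_on_subset[OF c] assms by auto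
    fix z assume z: "s < z" "z < 1"
    then obtain d where "d < 0" "(krn has_real_derivative d) (at z within {0..1})"
      using d[of z] assms by auto
    moreover from this have "(krn has_real_derivative d) (at z)"
      using z assms by (intro has_derivative_at_interior[of krn _ _ "{0..1}" 0 1]) auto
    ultimately show "\<exists>D. (krn has_real_derivative D) (at z) \<and> D < 0" by blast
  qed
  thus ?thesis using 0 by simp
qed

lemma flux_h_pos:
  assumes "rel_perm_wetting krw" "rel_perm_nonwetting krn" "M > 0" "0 < s" "s < 1"
  shows "0 < flux_h krw krn M s"
  unfolding flux_h_def flux_f_def
  using rel_perm_wetting_pos[OF assms(1), of s] rel_perm_nonwetting_pos[OF assms(2), of s] assms
  by (intro mult_pos_pos divide_pos_pos add_pos_pos) auto

lemma calG_C1: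
  assumes krw: "rel_perm_wetting krw" and krn: "rel_perm_nonwetting krn" and "M > 0"
    and F: "C_k_on 2 F {0..1}" and ab: "0 < a" "b < 1"
  shows "C_k_on 1 (\<lambda>s. calG F (flux_h krw krn M) s A \<alpha>) {a..b}"
proof -
  have sub: "C_k_on 1 f {a..b}" if "C_k_on 2 f {0..1}" for f
    by (rule C1_subset[OF C2_imp_C1[OF that]]) (use ab in auto)
  have k: "C_k_on 1 krw {a..b}" "C_k_on 1 krn {a..b}"
    using sub krw krn by (auto simp: rel_perm_wetting_def rel_perm_nonwetting_def simp del: C_k_on.simps)
  have "krw s + M * krn s \<noteq> 0" if "s \<in> {a..b}" for s
    using rel_perm_wetting_pos[OF krw, of s] rel_perm_nonwetting_pos[OF krn, of s] \<open>M > 0\<close> that ab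
    by (smt (verit) atLeastAtMost_iff mult_pos_pos)
  moreover have "flux_h krw krn M s \<noteq> 0" if "s \<in> {a..b}" for s
    using flux_h_pos[OF krw krn \<open>M > 0\<close>, of s] that ab by auto
  ultimately show ?thesis
    unfolding calG_def flux_h_def flux_f_def
    by (intro C1_divide C1_diff C1_mult C1_add C1_const C1_ident k sub[OF F]) auto
qed

lemma capillary_pressure_derivative:
  assumes "capillary_pressure pc" "s \<in> {0<..<1}"
  shows "(pc has_real_derivative deriv pc s) (at s)" "deriv pc s < 0"
proof -
  obtain d where "(pc has_real_derivative d) (at s within {0<..1})"
  proof -
    have "C_k_on 1 pc {0<..1}" using assms(1) unfolding capillary_pressure_def by blast
    moreover have "s \<in> {0<..1}" using assms(2) by simp
    ultimately show ?thesis using that unfolding C1_iff by blast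
  qed
  hence "(pc has_real_derivative d) (at s)"
    using assms(2) by (intro has_derivative_at_interior[of pc _ _ "{0<..1}" 0 1]) auto
  thus "(pc has_real_derivative deriv pc s) (at s)" using DERIV_imp_deriv by metis
  show "deriv pc s < 0" using assms by (auto simp: capillary_pressure_def)
qed

lemma capillary_pressure_C1:
  assumes "capillary_pressure pc" "0 < a" "b < 1"
  shows "C_k_on 1 pc {a..b}"
  by (rule C1_subset[of _ "{0<..1}"]) (use assms in \<open>auto simp: capillary_pressure_def simp del: C_k_on.simps\<close>)

section \<open>The critical imbibition solution\<close>

text \<open>The intermediate value theorem: \<open>\<tau>c\<close> is continuous, unbounded near \<open>S_star\<close> and smaller than \<open>\<tau>\<close>
  at \<open>S_bar\<close>.\<close>

lemma S_check_inverts_tau_c: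
  assumes \<tau>c: "is_tau_c pci SB w \<beta> S_star S_bar \<tau>c" and "S_star < S_bar" and \<tau>: "\<tau>c S_bar < \<tau>"
  shows "S_check \<tau>c S_star S_bar (\<tau>c S_bar) \<tau> \<in> {S_star<..<S_bar}"
    and "\<tau>c (S_check \<tau>c S_star S_bar (\<tau>c S_bar) \<tau>) = \<tau>"
proof -
  have cont: "continuous_on {S_star<..S_bar} \<tau>c" and lim: "filterlim \<tau>c at_top (at_right S_star)"
    using \<tau>c by (auto simp: is_tau_c_def)
  have "\<forall>\<^sub>F s in at_right S_star. \<tau> \<le> \<tau>c s" using lim unfolding filterlim_at_top by blast
  moreover have "\<forall>\<^sub>F s in at_right S_star. s \<in> {S_star<..<S_bar}"
    using \<open>S_star < S_bar\<close> by (rule eventually_at_right_real)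
  ultimately have "\<forall>\<^sub>F s in at_right S_star. \<tau> \<le> \<tau>c s \<and> s \<in> {S_star<..<S_bar}"
    by (rule eventually_conj)
  then obtain s where s: "\<tau> \<le> \<tau>c s" "s \<in> {S_star<..<S_bar}"
    using eventually_happens[of _ "at_right S_star"] by auto
  have "continuous_on {s..S_bar} \<tau>c" by (rule continuous_on_subset[OF cont]) (use s in auto)
  then obtain c where "s \<le> c" "c \<le> S_bar" "\<tau>c c = \<tau>"
    using IVT2'[of \<tau>c S_bar \<tau> s] s \<tau> by auto
  hence img: "\<tau> \<in> \<tau>c ` {S_star<..S_bar}" using s by force
  have S: "S_check \<tau>c S_star S_bar (\<tau>c S_bar) \<tau> = inv_into {S_star<..S_bar} \<tau>c \<tau>"
    using \<tau> by (simp add: S_check_def)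
  show eq: "\<tau>c (S_check \<tau>c S_star S_bar (\<tau>c S_bar) \<tau>) = \<tau>"
    unfolding S by (rule f_inv_into_f[OF img])
  have "S_check \<tau>c S_star S_bar (\<tau>c S_bar) \<tau> \<in> {S_star<..S_bar}"
    unfolding S by (rule inv_into_into[OF img])
  moreover have "S_check \<tau>c S_star S_bar (\<tau>c S_bar) \<tau> \<noteq> S_bar" using eq \<tau> by auto
  ultimately show "S_check \<tau>c S_star S_bar (\<tau>c S_bar) \<tau> \<in> {S_star<..<S_bar}" by auto
qed

lemma imbibition_solution_below:
  assumes u: "imbibition_solution F h pci SB \<tau> ST u" and m: "S_m pci SB u = B" and "SB < 1"
    and \<rho>: "\<rho> \<in> {SB<..<B}"
  shows "u \<rho> < pci \<rho>"
proof -
  let ?Z = "{S \<in> {SB<..<1}. \<forall>\<rho>\<in>{SB<..<S}. u \<rho> < pci \<rho>}"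
  have "\<forall>\<^sub>F S in at_right SB. u S < pci S" using u by (simp add: imbibition_solution_def)
  then obtain d where d: "d > SB" "\<And>y. y > SB \<Longrightarrow> y < d \<Longrightarrow> u y < pci y"
    unfolding eventually_at_right_field by blast
  have "(SB + min d 1) / 2 \<in> ?Z" using d \<open>SB < 1\<close> by (auto simp: min_def)
  hence ne: "?Z \<noteq> {}" by blast
  have bdd: "bdd_above ?Z" by (auto intro!: bdd_aboveI[of _ 1])
  have "\<rho> < Sup ?Z" using m \<rho> by (simp add: S_m_def)
  then obtain S where "S \<in> ?Z" "\<rho> < S" using less_cSup_iff[OF ne bdd] by blast
  thus ?thesis using \<rho> by auto
qed

text \<open>The energy computation along the imbibition solution, parametrised by the saturation:
  \<open>(pci - u)\<^sup>2 / 2 + c * \<Gamma>\<close> has derivative \<open>(pci - u) * pci' \<le> 0\<close>, and the square vanishes at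
  \<open>SB\<close> and is nonnegative at \<open>B\<close>.\<close>

lemma imbibition_potential_drop:
  assumes u: "imbibition_solution F h pci SB \<tau> ST u" and m: "S_m pci SB u = B"
    and B: "0 < SB" "SB < B" "B < 1"
    and c\<tau>: "0 < (F ST - F SB) / (ST - SB) * \<tau>"
    and pc: "capillary_pressure pci"
    and \<Gamma>: "continuous_on {SB..B} \<Gamma>"
      "\<And>S. S \<in> {SB<..<B} \<Longrightarrow> (\<Gamma> has_real_derivative calG F h S SB ST) (at S)"
  shows "\<Gamma> B \<le> \<Gamma> SB"
proof -
  define c where "c = (F ST - F SB) / (ST - SB) * \<tau>"
  have u_cont: "continuous_on {SB..B} u"
  proof -
    have "{SB..B} \<inter> {..<1} = {SB..B}" using B by auto
    thus ?thesis using u m by (simp add: imbibition_solution_def)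
  qed
  have u': "(u has_real_derivative c * calG F h S SB ST / (pci S - u S)) (at S)" if "S \<in> {SB<..<B}" for S
    using u m that unfolding imbibition_solution_def c_def by blast
  have pci_cont: "continuous_on {SB..B} pci"
    using C1_imp_continuous[OF capillary_pressure_C1[OF pc B(1,3)]] .
  define W where "W S = (pci S - u S)\<^sup>2 / 2 + c * \<Gamma> S" for S
  have "W B \<le> W SB"
  proof (rule DERIV_nonpos_imp_decreasing_open[of SB B])
    show "continuous_on {SB..B} W" unfolding W_def
      by (intro continuous_intros u_cont pci_cont \<Gamma>(1)) auto
    fix S assume "SB < S" "S < B"
    hence S: "S \<in> {SB<..<B}" "S \<in> {0<..<1}" using B by auto
    have lt: "u S < pci S" using imbibition_solution_below[OF u m _ S(1)] B by simp
    note p' = capillary_pressure_derivative[OF pc S(2)]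
    have "(W has_real_derivative
        (pci S - u S) * (deriv pci S - c * calG F h S SB ST / (pci S - u S)) + c * calG F h S SB ST) (at S)"
      unfolding W_def by (auto intro!: derivative_eq_intros p'(1) u'[OF S(1)] \<Gamma>(2)[OF S(1)])
    moreover have "(pci S - u S) * (deriv pci S - c * calG F h S SB ST / (pci S - u S)) + c * calG F h S SB ST
        = (pci S - u S) * deriv pci S"
      using lt by (simp add: right_diff_distrib)
    moreover have "(pci S - u S) * deriv pci S \<le> 0" using lt p'(2) by (intro mult_nonneg_nonpos) auto
    ultimately show "\<exists>D. (W has_real_derivative D) (at S) \<and> D \<le> 0" by auto
  qed (use B in simp)
  moreover have "W SB = c * \<Gamma> SB" using u by (simp add: W_def imbibition_solution_def)
  moreover have "c * \<Gamma> B \<le> W B" by (simp add: W_def)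
  ultimately have "c * \<Gamma> B \<le> c * \<Gamma> SB" by linarith
  moreover have "0 < c" using c\<tau> by (simp only: c_def)
  ultimately show ?thesis by (simp only: mult_le_cancel_left_pos)
qed

section \<open>The drainage orbit\<close>

theorem proposition3p9:
  fixes pci pcd krw krn F h \<beta> \<gamma> \<tau>c :: "real \<Rightarrow> real"
    and w :: "real \<Rightarrow> real \<Rightarrow> real \<Rightarrow> real"
    and M Ng So SB S_lower S_bar S_tilde S_star \<tau>_bar ST \<tau> SH c_d :: real
  assumes "capillary_pressure pci" and "capillary_pressure pcd"
    and "\<And>S. 0 < S \<Longrightarrow> S < 1 \<Longrightarrow> pci S < pcd S"
    and "rel_perm_wetting krw" and "rel_perm_nonwetting krn" and "M > 0"
    and "F = flux_F krw krn M Ng" and "h = flux_h krw krn M"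
    and "convex_concave_flux F So"
    and "SB \<in> {0<..<So}"
    and "is_S_lower F So S_lower"
    and "is_S_bar F SB S_bar"
    and "is_S_tilde F SB S_lower S_bar S_tilde"
    and "is_beta F SB S_tilde S_bar \<beta>"
    and "\<And>\<alpha>. \<alpha> \<in> {SB..S_bar} \<Longrightarrow> nonintegrable_near_1 (\<lambda>S. calG F h S SB \<alpha>)"
    and "is_gamma F h SB S_star \<gamma>"
    and "S_star \<in> {S_tilde<..<S_bar}" and "\<gamma> S_star = \<beta> S_star"
    and "\<And>t s. t > 0 \<Longrightarrow> s \<in> {SB<..S_bar} \<Longrightarrow> imbibition_solution F h pci SB t s (w t s)"
    and "is_tau_c pci SB w \<beta> S_star S_bar \<tau>c"
    and "\<tau>_bar = tau_m pci SB w S_bar" and "\<tau>_bar > 0"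
    and "(ST, \<tau>) \<in> region_B \<beta> \<tau>c S_star S_bar \<tau>_bar"
    and "SH = S_hat \<beta> \<tau>c S_star S_bar \<tau>_bar \<tau>"
    and "c_d = (F SH - F ST) / (SH - ST)"
  shows "\<exists>S_d p_d. tw_orbit F h pci pcd c_d \<tau> SH ST S_d p_d \<and>
           connects_point_to_segment S_d p_d (E_point pcd SH)
             (closed_segment (E_point pci ST) (E_point pcd ST))"
proof -
  note pci = assms(1) and pcd = assms(2) and pci_pcd = assms(3) and krw = assms(4) and krn = assms(5)
    and M = assms(6) and F = assms(7) and h = assms(8) and flux = assms(9) and w = assms(19)
    and \<tau>c = assms(20)
  define C where "C = S_check \<tau>c S_star S_bar \<tau>_bar \<tau>"
  have \<tau>_bar: "\<tau>_bar = \<tau>c S_bar" using \<tau>c assms(21) by (simp add: is_tau_c_def)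
  have \<tau>: "\<tau>_bar < \<tau>" and ST: "C < ST" "ST < SH" and SH: "SH = \<beta> C"
    using assms(23,24) by (auto simp: region_B_def S_hat_def C_def)
  have C: "C \<in> {S_star<..<S_bar}" "\<tau>c C = \<tau>"
    using S_check_inverts_tau_c[OF \<tau>c _ \<tau>[unfolded \<tau>_bar]] assms(17)
    unfolding C_def \<tau>_bar by simp_all
  have "SB \<le> S_tilde" using assms(13) by (auto simp: is_S_tilde_def split: if_splits)
  hence SB: "0 < SB" "SB < So" "SB < C" using assms(10,17) C by auto
  have So: "0 < So" "So < 1" using flux by (auto simp: convex_concave_flux_def)
  have \<beta>: "\<beta> s \<in> {S_bar..1}" "F (\<beta> s) = F SB + chord_slope F SB s * (\<beta> s - SB)"
    if "s \<in> {S_tilde..S_bar}" for s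
    using assms(14) that by (auto simp: is_beta_def)
  have SH1: "SH < 1"
  proof -
    have "\<beta> C < \<beta> S_star"
      using assms(14,17) C(1) by (auto simp: is_beta_def intro: monotone_onD)
    thus ?thesis using \<beta>(1)[of S_star] assms(17) SH by auto
  qed

  define c0 where "c0 = (F C - F SB) / (C - SB)"
  have SH_chord: "F SH = F SB + c0 * (SH - SB)"
    using \<beta>(2)[of C] C(1) assms(17) SB SH by (simp add: chord_slope_def c0_def)
  have C_chord: "F C = F SB + c0 * (C - SB)" using SB by (simp add: c0_def)
  note slopes = convex_concave_flux_slopes[OF flux]
  have c0: "0 < c0" using slopes(3)[of SB C] SB ST SH1 by (auto simp: c0_def)
  have c_d: "0 < c_d" using slopes(3)[of ST SH] SB ST SH1 assms(25) by auto

  \<comment> \<open>\<open>SB\<close>, \<open>C\<close> and \<open>SH\<close> are collinear on the graph of \<open>F\<close>, and \<open>ST\<close> lies between the last two.\<close>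
  have above_chord: "F SB + c0 * (ST - SB) < F ST"
    using convex_concave_sign(1)[OF increasing_slopes_minus_line[OF slopes(1), of "F SB" c0 SB]
        decreasing_slopes_minus_line[OF slopes(2), of "F SB" c0 SB], of SB C SH ST]
      SB ST SH1 SH_chord C_chord by simp
  define \<phi> where "\<phi> S = F S - (F SH + c_d * (S - SH))" for S
  have \<phi>_ST: "\<phi> ST = 0" using ST by (simp add: \<phi>_def assms(25) field_simps)
  \<comment> \<open>Both lines meet at \<open>SH\<close>, and the one through \<open>ST\<close> is less steep.\<close>
  have line: "F SB + c0 * (S - SB) < F SH + c_d * (S - SH)" if "S < SH" for S
  proof -
    have "c_d * (SH - ST) < c0 * (SH - ST)"
      using above_chord SH_chord \<phi>_ST by (simp add: \<phi>_def algebra_simps)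
    hence "c_d < c0" using ST by simp
    hence "c_d * (SH - S) < c0 * (SH - S)" using that by simp
    thus ?thesis using SH_chord by (simp add: algebra_simps)
  qed
  have \<phi>_SB: "\<phi> SB < 0" using line[of SB] SB ST by (simp add: \<phi>_def)
  have \<phi>_sign: "s \<in> {ST<..<SH} \<Longrightarrow> 0 < \<phi> s" "s \<in> {SB<..<ST} \<Longrightarrow> \<phi> s < 0" for s
    using convex_concave_sign[OF increasing_slopes_minus_line[OF slopes(1), of "F SH" c_d SH]
        decreasing_slopes_minus_line[OF slopes(2), of "F SH" c_d SH], of SB ST SH s]
      SB ST SH1 \<phi>_SB \<phi>_ST by (auto simp: \<phi>_def)

  let ?G = "\<lambda>S. calG F h S SH ST"
  have slope: "chord_slope F SH ST = c_d"
    using ST assms(25) by (simp add: chord_slope_def) (metis minus_diff_eq minus_divide_divide)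
  have G: "?G S = \<phi> S / h S" for S by (simp add: calG_def slope \<phi>_def algebra_simps)
  have hpos: "0 < h S" if "0 < S" "S < 1" for S using flux_h_pos[OF krw krn M that] h by simp
  have F2: "C_k_on 2 F {0..1}" using flux by (simp add: convex_concave_flux_def)
  have G_C1: "C_k_on 1 (\<lambda>S. calG F h S A \<alpha>) {SB..SH}" for A \<alpha>
    unfolding h by (rule calG_C1[OF krw krn M F2 SB(1) SH1])
  obtain \<Gamma> where \<Gamma>: "continuous_on {SB..SH} \<Gamma>"
    "\<And>S. S \<in> {SB<..<SH} \<Longrightarrow> (\<Gamma> has_real_derivative calG F h S SB C) (at S)"
    using continuous_has_primitive_on[OF C1_imp_continuous[OF G_C1]] by blast
  obtain \<Phi> where \<Phi>: "continuous_on {SB..SH} \<Phi>"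
    "\<And>S. S \<in> {SB<..<SH} \<Longrightarrow> (\<Phi> has_real_derivative ?G S) (at S)"
    using continuous_has_primitive_on[OF C1_imp_continuous[OF G_C1]] by blast
  \<comment> \<open>The two rims of the well: \<open>\<Phi>\<close> rises strictly less than \<open>\<Gamma>\<close>, and \<open>\<Gamma>\<close> does not rise.\<close>
  have "\<Gamma> SH \<le> \<Gamma> SB"
  proof (rule imbibition_potential_drop[OF w[of \<tau> C] _ SB(1) _ SH1 _ pci \<Gamma>])
    show "S_m pci SB (w \<tau> C) = SH"
      using \<tau>c C \<tau> assms(22) SH by (auto simp: is_tau_c_def)
    show "0 < (F C - F SB) / (C - SB) * \<tau>"
      by (rule mult_pos_pos) (use c0 \<tau> assms(22) in \<open>auto simp: c0_def\<close>)
  qed (use C SB ST \<tau> assms(22) in auto)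
  moreover have "\<Gamma> SB - \<Phi> SB < \<Gamma> SH - \<Phi> SH"
  proof (rule DERIV_pos_imp_increasing_open[of SB SH])
    fix S assume S: "SB < S" "S < SH"
    have "chord_slope F SB C = c0" using SB by (simp add: chord_slope_def c0_def)
    hence "calG F h S SB C - ?G S = ((F SH + c_d * (S - SH)) - (F SB + c0 * (S - SB))) / h S"
      by (simp add: G slope \<phi>_def calG_def diff_divide_distrib[symmetric] algebra_simps)
    also have "\<dots> > 0" using line[of S] S SB SH1 hpos[of S] by simp
    finally show "\<exists>D. ((\<lambda>S. \<Gamma> S - \<Phi> S) has_real_derivative D) (at S) \<and> 0 < D"
      using \<Gamma>(2)[of S] \<Phi>(2)[of S] S by (auto intro!: exI DERIV_diff)
  qed (use SB ST in \<open>auto intro!: continuous_intros \<Gamma> \<Phi>\<close>)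
  ultimately have \<Phi>_ends: "\<Phi> SH < \<Phi> SB" by linarith

  interpret hysteresis_system SB ST SH "c_d * \<tau>" pci pcd ?G \<Phi>
  proof
    show "SB < ST" "ST < SH" "0 < c_d * \<tau>" using SB ST c_d \<tau> assms(22) by auto
    show "\<exists>L. L-lipschitz_on {SB..SH} pci" "\<exists>L. L-lipschitz_on {SB..SH} pcd" "\<exists>L. L-lipschitz_on {SB..SH} ?G"
      by (intro C1_imp_lipschitz capillary_pressure_C1 G_C1 pci pcd SB(1) SH1)+
    show "?G SH = 0" by (simp add: calG_def)
    show "\<Phi> SH < \<Phi> SB" by (rule \<Phi>_ends)
  next
    fix s assume "s \<in> {SB<..<SH}"
    hence s: "s \<in> {0<..<1}" using SB SH1 by auto
    show "\<exists>D<0. (pci has_real_derivative D) (at s)" "\<exists>D<0. (pcd has_real_derivative D) (at s)"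
      using capillary_pressure_derivative[OF pci s] capillary_pressure_derivative[OF pcd s] by blast+
  next
    fix s assume "s \<in> {SB..SH}"
    thus "pci s \<le> pcd s" using pci_pcd[of s] SB SH1 by auto
  next
    fix s assume s: "s \<in> {SB<..<ST}"
    show "?G s < 0" unfolding G using \<phi>_sign(2)[OF s] hpos[of s] s SB ST SH1 by (simp add: divide_neg_pos)
  next
    fix s assume s: "s \<in> {ST<..<SH}"
    show "0 < ?G s" unfolding G using \<phi>_sign(1)[OF s] hpos[of s] s SB ST SH1 by simp
  qed (use \<Phi> in auto)

  obtain x where x: "solves velocity x" "\<And>t. fst (x t) \<in> {SB<..<SH}" "(x \<longlongrightarrow> (SH, pcd SH)) at_bot"
    "((\<lambda>t. infdist (x t) (closed_segment (ST, pci ST) (ST, pcd ST))) \<longlongrightarrow> 0) at_top"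
    using heteroclinic_orbit by blast
  have velocity_x: "velocity (x t) = (1 / (c_d * \<tau>) * calF pci pcd (fst (x t)) (snd (x t)), ?G (fst (x t)))" for t
  proof -
    have S: "fst (x t) \<in> {SB<..<SH}" by (rule x(2))
    hence "clamp_ab (fst (x t)) = fst (x t)" by (intro clamp_id) auto
    moreover have "pci (fst (x t)) < pcd (fst (x t))" using S SB SH1 by (intro pci_pcd) auto
    hence "imb (fst (x t)) (snd (x t)) - dra (fst (x t)) (snd (x t)) = calF pci pcd (fst (x t)) (snd (x t))"
      using S SB SH1 by (auto simp: imb_def dra_def calF_def H_dra_def H_imb_def)
    ultimately show ?thesis by (simp add: velocity_def)
  qed
  have "tw_orbit F h pci pcd c_d \<tau> SH ST (\<lambda>t. fst (x t)) (\<lambda>t. snd (x t))"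
    unfolding tw_orbit_def
  proof (intro allI conjI)
    fix t
    show "fst (x t) \<in> {0<..<1}" using x(2)[of t] SB SH1 by auto
    show "((\<lambda>t. fst (x t)) has_real_derivative
        1 / (c_d * \<tau>) * calF pci pcd (fst (x t)) (snd (x t))) (at t)"
      using solution_components(1)[OF x(1), of t] unfolding velocity_x fst_conv .
    show "((\<lambda>t. snd (x t)) has_real_derivative ?G (fst (x t))) (at t)"
      using solution_components(2)[OF x(1), of t] unfolding velocity_x snd_conv .
  qed
  moreover have "connects_point_to_segment (\<lambda>t. fst (x t)) (\<lambda>t. snd (x t)) (E_point pcd SH)
      (closed_segment (E_point pci ST) (E_point pcd ST))"
    using x(3,4) by (simp add: connects_point_to_segment_def E_point_def)
  ultimately show ?thesis by blast
qed

end
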